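(* Let $Q$ be a real $m\times n$ matrix with $Q^TQ=I_n$ and coherence $\mu=\max_{1\le j\le m}\|e_j^TQ\|_2^2$. Let $c$ be an integer with $n\le c\le m$, and let $S$ be a random sampling matrix produced, with inputs $m$ and $c$, by any one of the following three methods: uniform sampling without replacement, uniform sampling with replacement, or Bernoulli sampling. For $0<\epsilon<1$ and $f(x)\equiv e^x(1+x)^{-(1+x)}$ define $$\delta\equiv n\left(f(-\epsilon)^{c/(m\mu)}+f(\epsilon)^{c/(m\mu)}\right).$$ If $\delta<1$, then with probability at least $1-\delta$ we have $\operatorname{rank}(SQ)=n$ and $$\kappa(SQ)\le\sqrt{\frac{1+\epsilon}{1-\epsilon}}.$$
   Context: Here $e_1,\dots,e_m$ are the canonical (column) basis vectors of $\mathbb{R}^m$, $\|\cdot\|_2$ is the Euclidean two-norm (for vectors and matrices), and for a real matrix $Z$ of full column rank, $\kappa(Z)\equiv\|Z\|_2\|Z^\dagger\|_2$ is the two-norm condition number, with $Z^\dagger$ the Moore-Penrose inverse. The three sampling methods, for integers $m\ge1$ and $1\le c\le m$: (1) Uniform sampling without replacement: let $k_1,\dots,k_m$ be a uniformly random permutation of $1,\dots,m$, and let $S=\sqrt{m/c}\,\begin{pmatrix}e_{k_1}&\cdots&e_{k_c}\end{pmatrix}^T$, a $c\times m$ matrix. (2) Uniform sampling with replacement: let $k_1,\dots,k_c$ be independent and uniformly distributed on $\{1,\dots,m\}$, and let $S=\sqrt{m/c}\,\begin{pmatrix}e_{k_1}&\cdots&e_{k_c}\end{pmatrix}^T$, a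 $c\times m$ matrix. (3) Bernoulli sampling: $S$ is the $m\times m$ diagonal matrix whose diagonal elements $S_{tt}$, $1\le t\le m$, are independent, with $S_{tt}=\sqrt{m/c}$ with probability $c/m$ and $S_{tt}=0$ with probability $1-c/m$. *)

theory Defs
  imports "HOL-Analysis.Analysis" "HOL-Probability.Probability"
    "HOL-Combinatorics.Multiset_Permutations"
begin

text \<open>An \<open>m \<times> n\<close> matrix is an element of \<open>real^'n^'m\<close>, with \<open>m = CARD('m)\<close> and \<open>n = CARD('n)\<close>;
  the norm on \<open>real^'n\<close> is the Euclidean one, so \<open>onorm\<close> below is the matrix two-norm.\<close>

definition mat_norm2 :: "real^'n^'m \<Rightarrow> real" where
  "mat_norm2 Z = onorm ((*v) Z)"

definition is_moore_penrose :: "real^'n^'m \<Rightarrow> real^'m^'n \<Rightarrow> bool" where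
  "is_moore_penrose Z X \<longleftrightarrow>
     Z ** X ** Z = Z \<and> X ** Z ** X = X \<and>
     transpose (Z ** X) = Z ** X \<and> transpose (X ** Z) = X ** Z"

definition moore_penrose :: "real^'n^'m \<Rightarrow> real^'m^'n" where
  "moore_penrose Z = (THE X. is_moore_penrose Z X)"

definition cond2 :: "real^'n^'m \<Rightarrow> real" where
  "cond2 Z = mat_norm2 Z * mat_norm2 (moore_penrose Z)"

lemma is_moore_penrose_unique:
  assumes "is_moore_penrose Z X" "is_moore_penrose Z Y"
  shows "X = Y"
proof -
  note X = assms(1)[unfolded is_moore_penrose_def]
  note Y = assms(2)[unfolded is_moore_penrose_def]
  have ZX: "Z ** X = Z ** Y"
  proof -
    have "Z ** X = transpose (Z ** X)" using X by simp
    also have "\<dots> = transpose ((Z ** Y) ** (Z ** X))"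
      using Y by (simp add: matrix_mul_assoc)
    also have "\<dots> = transpose (Z ** X) ** transpose (Z ** Y)"
      by (simp only: matrix_transpose_mul)
    also have "\<dots> = (Z ** X) ** (Z ** Y)" using X Y by simp
    also have "\<dots> = Z ** Y" using X by (simp add: matrix_mul_assoc)
    finally show ?thesis .
  qed
  have XZ: "X ** Z = Y ** Z"
  proof -
    have "X ** Z = transpose (X ** Z)" using X by simp
    also have "\<dots> = transpose ((X ** Z) ** (Y ** Z))"
      using Y by (simp add: matrix_mul_assoc[symmetric])
    also have "\<dots> = transpose (Y ** Z) ** transpose (X ** Z)"
      by (simp only: matrix_transpose_mul)
    also have "\<dots> = (Y ** Z) ** (X ** Z)" using X Y by simp
    also have "\<dots> = Y ** Z" using X by (simp add: matrix_mul_assoc[symmetric])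
    finally show ?thesis .
  qed
  have "X = X ** Z ** X" using X by simp
  also have "\<dots> = Y ** (Z ** X)" by (simp add: XZ matrix_mul_assoc)
  also have "\<dots> = Y ** Z ** Y" by (simp add: ZX matrix_mul_assoc)
  also have "\<dots> = Y" using Y by simp
  finally show ?thesis .
qed

lemma moore_penrose_eqI: "is_moore_penrose Z X \<Longrightarrow> moore_penrose Z = X"
  unfolding moore_penrose_def by (blast intro: is_moore_penrose_unique)

lemma is_moore_penrose_full_column_rank:
  fixes Z :: "real^'n^'m"
  assumes "rank Z = CARD('n)"
  shows "is_moore_penrose Z (moore_penrose Z)"
proof -
  define G where "G = transpose Z ** Z"
  have "x = 0" if "G *v x = 0" for x
  proof -
    have "(Z *v x) \<bullet> (Z *v x) = x \<bullet> (G *v x)"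
      unfolding G_def
      by (metis dot_lmul_matrix inner_commute matrix_vector_mul_assoc transpose_matrix_vector)
    then have "Z *v x = 0" using that by simp
    then show ?thesis using assms
      by (metis full_rank_injective injD matrix_vector_mult_0_right)
  qed
  then have "\<exists>H. H ** G = mat 1"
    by (simp add: matrix_left_invertible_ker)
  then obtain H where HG: "H ** G = mat 1" by blast
  then have GH: "G ** H = mat 1" by (simp add: matrix_left_right_inverse)
  have GT: "transpose G = G" by (simp add: G_def matrix_transpose_mul)
  have "transpose H = transpose H ** (G ** H)" by (simp add: GH)
  also have "\<dots> = transpose (G ** H) ** H"
    by (simp add: matrix_transpose_mul GT matrix_mul_assoc)
  also have "\<dots> = H" by (simp add: GH)
  finally have HT: "transpose H = H" .
  have XZ: "(H ** transpose Z) ** Z = mat 1"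
    using HG by (simp add: G_def matrix_mul_assoc)
  have "is_moore_penrose Z (H ** transpose Z)"
    unfolding is_moore_penrose_def
    by (simp add: XZ matrix_mul_assoc[symmetric, of Z "H ** transpose Z" Z])
       (simp add: matrix_transpose_mul HT matrix_mul_assoc)
  then show ?thesis using moore_penrose_eqI by metis
qed

definition coherence :: "real^'n^'m \<Rightarrow> real" where
  "coherence Q = Max (range (\<lambda>j. (norm (axis j 1 v* Q))\<^sup>2))"

definition selection_matrix :: "('c \<Rightarrow> 'm) \<Rightarrow> real^'m^'c" where
  "selection_matrix k = (\<chi> i. sqrt (real CARD('m) / real CARD('c)) *\<^sub>R axis (k i) 1)"

text \<open>The \<open>c\<close> rows are labelled by the type \<open>'c\<close>; \<open>r\<close> is a numbering of these labels by
  \<open>0, \<dots>, c - 1\<close>, so that row \<open>i\<close> receives entry number \<open>r i\<close> of the random permutation.\<close>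

definition uniform_without_replacement :: "('c \<Rightarrow> nat) \<Rightarrow> (real^'m^'c) pmf" where
  "uniform_without_replacement r =
     map_pmf (\<lambda>ks. selection_matrix (\<lambda>i. ks ! r i))
       (pmf_of_set (permutations_of_set (UNIV :: 'm set)))"

definition uniform_with_replacement :: "(real^'m^'c) pmf" where
  "uniform_with_replacement =
     map_pmf selection_matrix
       (Pi_pmf (UNIV :: 'c set) undefined (\<lambda>_. pmf_of_set (UNIV :: 'm set)))"

definition bernoulli_sampling :: "nat \<Rightarrow> (real^'m^'m) pmf" where
  "bernoulli_sampling c =
     map_pmf (\<lambda>d. \<chi> s t. if s = t then d t else 0)
       (Pi_pmf (UNIV :: 'm set) 0
         (\<lambda>_. map_pmf (\<lambda>b. if b then sqrt (real CARD('m) / real c) else 0)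
                (bernoulli_pmf (real c / real CARD('m)))))"

definition chernoff_f :: "real \<Rightarrow> real" where
  "chernoff_f x = exp x * (1 + x) powr (- (1 + x))"

end

theory Submission
  imports Defs
begin

text \<open>The quadratic form \<open>\<parallel>SQx\<parallel>\<^sup>2 = x\<^sup>T A x\<close> belongs to a sum \<open>A\<close> of random rank-one terms
  \<open>w w\<^sup>T\<close> with \<open>\<parallel>w\<parallel>\<^sup>2 \<le> L = m\<mu>/c\<close>, and \<open>E A = I\<close>. Markov's inequality for \<open>tr exp (bA)\<close>, with
  \<open>b = ln (1 \<plusminus> \<epsilon>) / L\<close>, reduces the claim to \<open>E tr exp (bA) \<le> n exp ((e\<^sup>b\<^sup>L - 1) / L)\<close>. Terms are
  averaged one at a time: Golden--Thompson for a rank-one summand bounds \<open>E tr exp (H + b w w\<^sup>T)\<close> by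
  \<open>tr (e\<^sup>H (I + K))\<close> with \<open>K = (e\<^sup>b\<^sup>L - 1) / L E (w w\<^sup>T)\<close>, and Klein's inequality bounds this by
  \<open>tr exp (H + K)\<close>. Sampling without replacement is treated by conditioning on the first draw.\<close>

subsection \<open>Self-adjoint operators and trace exponentials\<close>

definition selfadjoint :: "('a::real_inner \<Rightarrow> 'a) \<Rightarrow> bool" where
  "selfadjoint f \<longleftrightarrow> linear f \<and> (\<forall>x y. f x \<bullet> y = x \<bullet> f y)"

definition orthonormal :: "'a::real_inner set \<Rightarrow> bool" where
  "orthonormal B \<longleftrightarrow> pairwise orthogonal B \<and> (\<forall>b\<in>B. norm b = 1)"

text \<open>For a unit vector the eigenvalue must be the Rayleigh quotient
  \<open>b \<bullet> f b\<close>, so a bare set of vectors encodes the whole spectral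
  decomposition.\<close>

definition eigenbasis :: "('a::euclidean_space \<Rightarrow> 'a) \<Rightarrow> 'a set \<Rightarrow> bool" where
  "eigenbasis f B \<longleftrightarrow> orthonormal B \<and> span B = UNIV \<and> (\<forall>b\<in>B. f b = (b \<bullet> f b) *\<^sub>R b)"

lemma selfadjoint_add:
  "selfadjoint f \<Longrightarrow> selfadjoint g \<Longrightarrow> selfadjoint (\<lambda>x. f x + g x)"
  by (auto simp: selfadjoint_def linear_compose_add inner_simps)

lemma selfadjoint_scaleR: "selfadjoint f \<Longrightarrow> selfadjoint (\<lambda>x. c *\<^sub>R f x)"
  by (auto simp: selfadjoint_def linear_compose_scale_right)

lemma selfadjoint_ident: "selfadjoint (\<lambda>x. x)"
  by (auto simp: selfadjoint_def intro: linearI)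

lemma selfadjoint_scaleR_ident: "selfadjoint ((*\<^sub>R) c)"
  by (auto simp: selfadjoint_def intro!: linear_compose_scale_right linearI simp: algebra_simps)

lemma selfadjoint_zero: "selfadjoint (\<lambda>x. 0)"
  by (auto simp: selfadjoint_def intro: linearI)

lemma selfadjoint_sum:
  "(\<And>i. i \<in> I \<Longrightarrow> selfadjoint (f i)) \<Longrightarrow> selfadjoint (\<lambda>x. \<Sum>i\<in>I. f i x)"
  by (induction I rule: infinite_finite_induct) (auto intro: selfadjoint_zero selfadjoint_add)

definition rank_one :: "'a::real_inner \<Rightarrow> 'a \<Rightarrow> 'a" where
  "rank_one w x = (w \<bullet> x) *\<^sub>R w"

lemma selfadjoint_rank_one: "selfadjoint (rank_one w)"
  by (auto simp: selfadjoint_def rank_one_def inner_simps inner_commute algebra_simps intro!: linearI)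

lemmas selfadjoint_intros = selfadjoint_add selfadjoint_scaleR
  selfadjoint_scaleR_ident selfadjoint_ident selfadjoint_zero selfadjoint_sum selfadjoint_rank_one

lemma selfadjointD: "selfadjoint f \<Longrightarrow> f x \<bullet> y = x \<bullet> f y"
  by (auto simp: selfadjoint_def)

section \<open>The spectral theorem\<close>

lemma orthonormal_imp_independent: "orthonormal B \<Longrightarrow> independent B"
  by (metis norm_zero orthonormal_def pairwise_orthogonal_independent zero_neq_one)

lemma orthonormal_imp_finite: "orthonormal B \<Longrightarrow> finite (B :: 'a::euclidean_space set)"
  using independent_bound orthonormal_imp_independent by blast

lemma orthonormal_card_le: "orthonormal (B :: 'a::euclidean_space set) \<Longrightarrow> card B \<le> DIM('a)"
  using independent_bound orthonormal_imp_independent by blast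

text \<open>A unit vector maximising \<open>x \<bullet> f x\<close> over the unit sphere of an invariant subspace is an
  eigenvector.\<close>

lemma selfadjoint_eigenvector:
  fixes f :: "'a::euclidean_space \<Rightarrow> 'a"
  assumes f: "selfadjoint f" and S: "subspace S" "S \<noteq> {0}" and inv: "f ` S \<subseteq> S"
  obtains v where "v \<in> S" "norm v = 1" "f v = (v \<bullet> f v) *\<^sub>R v"
proof -
  have lin: "linear f" using f by (simp add: selfadjoint_def)
  define T where "T = sphere 0 1 \<inter> S"
  have cT: "compact T"
    unfolding T_def using S(1) by (intro compact_Int_closed closed_subspace) auto
  obtain z where z: "z \<in> S" "z \<noteq> 0" using S subspace_0 by auto
  have "z /\<^sub>R norm z \<in> T" using z S(1) by (auto simp: T_def subspace_scale)
  then have "T \<noteq> {}" by blast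
  moreover have "continuous_on T (\<lambda>x. x \<bullet> f x)"
    by (intro continuous_intros linear_continuous_on lin[unfolded linear_conv_bounded_linear])
  ultimately obtain v where v: "v \<in> T" and max: "\<And>x. x \<in> T \<Longrightarrow> x \<bullet> f x \<le> v \<bullet> f v"
    using continuous_attains_sup[OF cT] by blast
  have nv: "norm v = 1" and vS: "v \<in> S" using v by (auto simp: T_def)
  have vv: "v \<bullet> v = 1" using nv by (simp add: norm_eq_1)
  have max': "x \<bullet> f x \<le> (v \<bullet> f v) * (x \<bullet> x)" if "x \<in> S" for x
  proof (cases "x = 0")
    case False
    have "(x /\<^sub>R norm x) \<in> T" using that False S(1) by (auto simp: T_def subspace_scale)
    from max[OF this] have "(x \<bullet> f x) / (norm x)\<^sup>2 \<le> v \<bullet> f v"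
      by (simp add: linear_cmul[OF lin] power2_eq_square field_simps)
    then show ?thesis using False by (simp add: field_simps power2_norm_eq_inner)
  qed (simp add: linear_0[OF lin])
  \<comment> \<open>\<open>w\<close> is the component of \<open>f v\<close> orthogonal to
    \<open>v\<close>. If it were nonzero, moving from \<open>v\<close> towards \<open>w\<close>
    would increase the Rayleigh quotient to first order.\<close>
  define w where "w = f v - (v \<bullet> f v) *\<^sub>R v"
  have wS: "w \<in> S"
    unfolding w_def using inv vS S(1) by (auto intro!: subspace_diff subspace_scale)
  have vw: "v \<bullet> w = 0" by (simp add: w_def inner_simps vv)
  have wfv: "w \<bullet> f v = w \<bullet> w"
    using vw by (simp add: w_def inner_simps inner_commute vv)
  have "2 * t * (w \<bullet> w) \<le> t\<^sup>2 * ((v \<bullet> f v) * (w \<bullet> w) - w \<bullet> f w)" for t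
  proof -
    have e1: "(v + t *\<^sub>R w) \<bullet> f (v + t *\<^sub>R w) = v \<bullet> f v + 2 * t * (w \<bullet> w) + t\<^sup>2 * (w \<bullet> f w)"
      using selfadjointD[OF f, of v w] wfv
      by (simp add: linear_add[OF lin] linear_cmul[OF lin] inner_simps power2_eq_square inner_commute)
    have e2: "(v + t *\<^sub>R w) \<bullet> (v + t *\<^sub>R w) = 1 + t\<^sup>2 * (w \<bullet> w)"
      using vw by (simp add: inner_simps power2_eq_square vv inner_commute)
    have "v + t *\<^sub>R w \<in> S" using vS wS S(1) by (auto intro!: subspace_add subspace_scale)
    from max'[OF this] show ?thesis unfolding e1 e2 by (simp add: algebra_simps)
  qed
  note quad = this
  have "w \<bullet> w \<le> 0"
  proof (rule ccontr)
    assume "\<not> w \<bullet> w \<le> 0"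
    define a where "a = w \<bullet> w"
    \<comment> \<open>\<open>d\<close> is positive and bounds the coefficient of the quadratic term,
      so t = a / d yields 2 a^2 / d \<le> a^2 / d.\<close>
    define d where "d = \<bar>(v \<bullet> f v) * (w \<bullet> w) - w \<bullet> f w\<bar> + 1"
    have a: "a > 0" using \<open>\<not> w \<bullet> w \<le> 0\<close> unfolding a_def by linarith
    have d: "d > 0" by (simp add: d_def add_nonneg_pos)
    have "2 * (a / d) * a \<le> (a / d)\<^sup>2 * d"
      by (rule order_trans[OF quad[of "a / d", folded a_def]])
         (auto intro!: mult_left_mono simp: d_def a_def)
    also have "\<dots> = (a / d) * a" using d by (simp add: power2_eq_square)
    finally show False using a d by (simp add: field_simps)
  qed
  then have "w = 0" by (meson inner_gt_zero_iff not_le)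
  then show ?thesis using that vS nv by (simp add: w_def)
qed

text \<open>An orthonormal set of eigenvectors of maximal cardinality spans: otherwise its
  orthogonal complement is a nonzero invariant subspace, which contains one more unit
  eigenvector.\<close>

lemma eigenbasis_exists:
  fixes f :: "'a::euclidean_space \<Rightarrow> 'a"
  assumes f: "selfadjoint f"
  shows "\<exists>B. eigenbasis f B"
proof -
  define P where "P B \<longleftrightarrow> orthonormal B \<and> (\<forall>b\<in>B. f b = (b \<bullet> f b) *\<^sub>R b)" for B
  have "P {}" by (simp add: P_def orthonormal_def)
  moreover have "\<forall>B. P B \<longrightarrow> card B < Suc DIM('a)"
    by (simp add: P_def orthonormal_card_le less_Suc_eq_le)
  ultimately have "\<exists>B. P B \<and> (\<forall>C. P C \<longrightarrow> card C \<le> card B)"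
    by (rule ex_has_greatest_nat)
  then obtain B where B: "P B" and max: "\<And>C. P C \<Longrightarrow> card C \<le> card B" by blast
  have "span B = UNIV"
  proof (rule ccontr)
    assume "span B \<noteq> UNIV"
    define S where "S = {x. \<forall>b\<in>B. b \<bullet> x = 0}"
    have S: "subspace S" by (auto simp: S_def subspace_def inner_simps)
    have "span B \<subset> UNIV" using \<open>span B \<noteq> UNIV\<close> by blast
    then obtain z where "z \<noteq> 0" "\<And>y. y \<in> span B \<Longrightarrow> orthogonal z y"
      using orthogonal_to_subspace_exists_gen[of B UNIV] by auto
    then have "z \<in> S" by (auto simp: S_def orthogonal_def span_base inner_commute)
    then have "S \<noteq> {0}" using \<open>z \<noteq> 0\<close> by blast
    moreover have "f ` S \<subseteq> S"
    proof clarify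
      fix x assume "x \<in> S"
      have "b \<bullet> f x = 0" if "b \<in> B" for b
      proof -
        have "b \<bullet> f x = f b \<bullet> x" by (simp add: selfadjointD[OF f])
        also have "\<dots> = ((b \<bullet> f b) *\<^sub>R b) \<bullet> x" using B that by (simp only: P_def)
        finally show ?thesis using \<open>x \<in> S\<close> that by (simp add: S_def)
      qed
      then show "f x \<in> S" by (simp add: S_def)
    qed
    ultimately obtain v where v: "v \<in> S" "norm v = 1" "f v = (v \<bullet> f v) *\<^sub>R v"
      using selfadjoint_eigenvector[OF f S] by blast
    have "v \<notin> B" using v by (auto simp: S_def norm_eq_1)
    have "P (insert v B)"
      using B v by (auto simp: P_def orthonormal_def pairwise_insert orthogonal_def S_def inner_commute)
    from max[OF this] show False
      using \<open>v \<notin> B\<close> B by (simp add: P_def orthonormal_imp_finite)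
  qed
  then show ?thesis using B by (auto simp: P_def eigenbasis_def)
qed

definition the_eigenbasis :: "('a::euclidean_space \<Rightarrow> 'a) \<Rightarrow> 'a set" where
  "the_eigenbasis f = (SOME B. eigenbasis f B)"

lemma eigenbasis_the_eigenbasis: "selfadjoint f \<Longrightarrow> eigenbasis f (the_eigenbasis f)"
  unfolding the_eigenbasis_def by (rule someI_ex) (rule eigenbasis_exists)

lemma finite_eigenbasis: "eigenbasis f B \<Longrightarrow> finite B"
  by (auto simp: eigenbasis_def orthonormal_imp_finite)

lemma eigenbasis_expand:
  "eigenbasis f B \<Longrightarrow> (\<Sum>b\<in>B. (x \<bullet> b) *\<^sub>R b) = x"
  by (rule orthonormal_basis_expand)
     (auto simp: eigenbasis_def orthonormal_def intro: orthonormal_imp_finite)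

lemma eigenbasis_inner:
  assumes "eigenbasis f B"
  shows "x \<bullet> y = (\<Sum>b\<in>B. (x \<bullet> b) * (y \<bullet> b))"
proof -
  have "x \<bullet> y = x \<bullet> (\<Sum>b\<in>B. (y \<bullet> b) *\<^sub>R b)" by (simp add: eigenbasis_expand[OF assms])
  also have "\<dots> = (\<Sum>b\<in>B. (x \<bullet> b) * (y \<bullet> b))" by (simp add: inner_sum_right mult.commute)
  finally show ?thesis .
qed

lemma eigenbasis_norm: "eigenbasis f B \<Longrightarrow> b \<in> B \<Longrightarrow> b \<bullet> b = 1"
  by (auto simp: eigenbasis_def orthonormal_def norm_eq_1)

lemma eigenbasis_card: "eigenbasis (f :: 'a::euclidean_space \<Rightarrow> 'a) B \<Longrightarrow> card B = DIM('a)"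
  by (metis basis_card_eq_dim dim_UNIV eigenbasis_def orthonormal_imp_independent subset_UNIV)

lemma eigenbasis_apply_inner:
  assumes "selfadjoint f" "eigenbasis f B" "b \<in> B"
  shows "f x \<bullet> b = (b \<bullet> f b) * (x \<bullet> b)"
  by (metis assms eigenbasis_def inner_scaleR_right selfadjointD)

lemma eigenbasis_quadratic_form:
  assumes "selfadjoint f" "eigenbasis f B"
  shows "x \<bullet> f x = (\<Sum>b\<in>B. (x \<bullet> b)\<^sup>2 * (b \<bullet> f b))"
  by (subst eigenbasis_inner[OF assms(2)])
     (auto intro!: sum.cong simp: eigenbasis_apply_inner[OF assms] power2_eq_square)

lemma eigenbasis_sum_squares:
  "eigenbasis f B \<Longrightarrow> (\<Sum>b\<in>B. (x \<bullet> b)\<^sup>2) = x \<bullet> x"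
  by (subst eigenbasis_inner) (auto simp: power2_eq_square)

section \<open>Trace exponentials and convexity\<close>

text \<open>For self-adjoint \<open>f\<close> this is tr e^f, summed over the eigenvalues with
  multiplicity.\<close>

definition trexp :: "('a::euclidean_space \<Rightarrow> 'a) \<Rightarrow> real" where
  "trexp f = (\<Sum>b\<in>the_eigenbasis f. exp (b \<bullet> f b))"

text \<open>For self-adjoint \<open>f\<close> this is the quadratic form x^T e^f x; its independence
  of the chosen eigenbasis is \<open>exp_form_eq\<close>.\<close>

definition exp_form :: "('a::euclidean_space \<Rightarrow> 'a) \<Rightarrow> 'a \<Rightarrow> real" where
  "exp_form f x = (\<Sum>b\<in>the_eigenbasis f. (x \<bullet> b)\<^sup>2 * exp (b \<bullet> f b))"

lemma exp_form_nonneg: "exp_form f x \<ge> 0"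
  by (auto simp: exp_form_def intro!: sum_nonneg)

text \<open>Klein's inequality: the spectral form of the tangent line inequality for \<open>exp\<close>, since
  \<open>(b \<bullet> c)\<^sup>2\<close> is doubly stochastic for two orthonormal bases.\<close>

lemma trexp_tangent:
  fixes f h :: "'a::euclidean_space \<Rightarrow> 'a"
  assumes f: "selfadjoint f" and h: "selfadjoint h"
  shows "trexp f + (\<Sum>b\<in>the_eigenbasis f. exp (b \<bullet> f b) * (b \<bullet> h b)) \<le> trexp (\<lambda>x. f x + h x)"
proof -
  define g where "g = (\<lambda>x. f x + h x)"
  define B where "B = the_eigenbasis f"
  define C where "C = the_eigenbasis g"
  have g: "selfadjoint g" unfolding g_def by (intro selfadjoint_intros f h)
  have B: "eigenbasis f B" and C: "eigenbasis g C"
    using eigenbasis_the_eigenbasis f g by (auto simp: B_def C_def)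
  have "trexp f + (\<Sum>b\<in>B. exp (b \<bullet> f b) * (b \<bullet> h b))
      = (\<Sum>b\<in>B. exp (b \<bullet> f b) * (1 + b \<bullet> g b - b \<bullet> f b))"
    by (simp add: trexp_def B_def[symmetric] g_def inner_simps algebra_simps sum.distrib)
  \<comment> \<open>Both 1 and \<open>b \<bullet> g b\<close> are averages over \<open>C\<close>
    with weights \<open>(b \<bullet> c)\<^sup>2\<close>, so the scalar inequality can be applied to
    each pair of eigenvalues.\<close>
  also have "\<dots> = (\<Sum>b\<in>B. exp (b \<bullet> f b) * (\<Sum>c\<in>C. (b \<bullet> c)\<^sup>2 * (1 + c \<bullet> g c - b \<bullet> f b)))"
  proof (rule sum.cong[OF refl])
    fix b assume b: "b \<in> B"
    have "(\<Sum>c\<in>C. (b \<bullet> c)\<^sup>2 * (1 + c \<bullet> g c - b \<bullet> f b))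
      = (\<Sum>c\<in>C. (b \<bullet> c)\<^sup>2 * (c \<bullet> g c)) + (1 - b \<bullet> f b) * (\<Sum>c\<in>C. (b \<bullet> c)\<^sup>2)"
      by (simp add: sum_distrib_left sum.distrib[symmetric] algebra_simps)
    also have "\<dots> = b \<bullet> g b + (1 - b \<bullet> f b)"
      using eigenbasis_quadratic_form[OF g C, of b] eigenbasis_sum_squares[OF C, of b] eigenbasis_norm[OF B b]
      by simp
    finally show "exp (b \<bullet> f b) * (1 + b \<bullet> g b - b \<bullet> f b) =
      exp (b \<bullet> f b) * (\<Sum>c\<in>C. (b \<bullet> c)\<^sup>2 * (1 + c \<bullet> g c - b \<bullet> f b))" by simp
  qed
  also have "\<dots> = (\<Sum>b\<in>B. \<Sum>c\<in>C. (b \<bullet> c)\<^sup>2 * (exp (b \<bullet> f b) * (1 + (c \<bullet> g c - b \<bullet> f b))))"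
    by (simp add: sum_distrib_left mult_ac add_diff_eq)
  also have "\<dots> \<le> (\<Sum>b\<in>B. \<Sum>c\<in>C. (b \<bullet> c)\<^sup>2 * (exp (b \<bullet> f b) * exp (c \<bullet> g c - b \<bullet> f b)))"
    by (intro sum_mono mult_left_mono exp_ge_add_one_self) auto
  also have "\<dots> = (\<Sum>b\<in>B. \<Sum>c\<in>C. (b \<bullet> c)\<^sup>2 * exp (c \<bullet> g c))"
    by (simp add: exp_diff)
  also have "\<dots> = (\<Sum>c\<in>C. (\<Sum>b\<in>B. (c \<bullet> b)\<^sup>2) * exp (c \<bullet> g c))"
    by (subst sum.swap) (simp add: sum_distrib_right inner_commute)
  also have "\<dots> = trexp g"
    by (simp add: trexp_def C_def[symmetric] eigenbasis_sum_squares[OF B] eigenbasis_norm[OF C])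
  finally show ?thesis by (simp add: g_def B_def)
qed

text \<open>Jensen's inequality for the weights \<open>(x \<bullet> b)\<^sup>2\<close>, which sum to
  1, obtained from the tangent of exp at \<open>x \<bullet> f x\<close>; each weight is then bounded
  by 1.\<close>

lemma exp_quadratic_form_le_trexp:
  assumes f: "selfadjoint f" and x: "norm x = 1"
  shows "exp (x \<bullet> f x) \<le> trexp f"
proof -
  define B where "B = the_eigenbasis f"
  have B: "eigenbasis f B" using eigenbasis_the_eigenbasis f by (auto simp: B_def)
  have xx: "(\<Sum>b\<in>B. (x \<bullet> b)\<^sup>2) = 1" using x by (simp add: eigenbasis_sum_squares[OF B] norm_eq_1)
  define a where "a = x \<bullet> f x"
  have "exp a = (\<Sum>b\<in>B. (x \<bullet> b)\<^sup>2 * (exp a * (1 + (b \<bullet> f b - a))))"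
  proof -
    have "(\<Sum>b\<in>B. (x \<bullet> b)\<^sup>2 * (exp a * (1 + (b \<bullet> f b - a))))
       = exp a * ((1 - a) * (\<Sum>b\<in>B. (x \<bullet> b)\<^sup>2) + (\<Sum>b\<in>B. (x \<bullet> b)\<^sup>2 * (b \<bullet> f b)))"
      by (simp add: sum_distrib_left sum.distrib[symmetric] algebra_simps)
    also have "\<dots> = exp a"
      unfolding xx using eigenbasis_quadratic_form[OF f B, of x] by (simp add: a_def)
    finally show ?thesis by simp
  qed
  also have "\<dots> \<le> (\<Sum>b\<in>B. (x \<bullet> b)\<^sup>2 * (exp a * exp (b \<bullet> f b - a)))"
    by (intro sum_mono mult_left_mono exp_ge_add_one_self) auto
  also have "\<dots> \<le> (\<Sum>b\<in>B. 1 * exp (b \<bullet> f b))"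
  proof (rule sum_mono)
    fix b assume b: "b \<in> B"
    have "(x \<bullet> b)\<^sup>2 \<le> (\<Sum>b\<in>B. (x \<bullet> b)\<^sup>2)"
      using b finite_eigenbasis[OF B] by (intro member_le_sum) auto
    then show "(x \<bullet> b)\<^sup>2 * (exp a * exp (b \<bullet> f b - a)) \<le> 1 * exp (b \<bullet> f b)"
      by (simp add: xx exp_diff)
  qed
  finally show ?thesis by (simp add: trexp_def B_def a_def)
qed

section \<open>Power moments and the exponential series\<close>

lemma funpow_eigenbasis_inner:
  assumes "selfadjoint f" "eigenbasis f B" "b \<in> B"
  shows "(f ^^ k) x \<bullet> b = (b \<bullet> f b) ^ k * (x \<bullet> b)"
  by (induction k) (simp_all add: eigenbasis_apply_inner[OF assms])

lemma funpow_quadratic_form: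
  assumes "selfadjoint f" "eigenbasis f B"
  shows "x \<bullet> (f ^^ k) x = (\<Sum>b\<in>B. (x \<bullet> b)\<^sup>2 * (b \<bullet> f b) ^ k)"
  by (subst eigenbasis_inner[OF assms(2)])
     (auto intro!: sum.cong simp: funpow_eigenbasis_inner[OF assms] power2_eq_square)

text \<open>The terms of the series are free of \<open>B\<close>, so the limit is the same for every
  eigenbasis. The series also lets exponential forms be compared moment by moment.\<close>

lemma exp_form_sums_aux:
  assumes "selfadjoint f" "eigenbasis f B"
  shows "(\<lambda>k. (x \<bullet> (f ^^ k) x) / fact k) sums (\<Sum>b\<in>B. (x \<bullet> b)\<^sup>2 * exp (b \<bullet> f b))"
proof -
  have "(\<lambda>k. \<Sum>b\<in>B. (x \<bullet> b)\<^sup>2 * ((b \<bullet> f b) ^ k /\<^sub>R fact k)) sums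
      (\<Sum>b\<in>B. (x \<bullet> b)\<^sup>2 * exp (b \<bullet> f b))"
    by (intro sums_sum sums_mult exp_converges)
  moreover have "(\<Sum>b\<in>B. (x \<bullet> b)\<^sup>2 * ((b \<bullet> f b) ^ k /\<^sub>R fact k)) = (x \<bullet> (f ^^ k) x) / fact k" for k
    by (simp add: funpow_quadratic_form[OF assms] sum_divide_distrib divide_simps)
  ultimately show ?thesis by simp
qed

lemma exp_form_sums:
  "selfadjoint f \<Longrightarrow> (\<lambda>k. (x \<bullet> (f ^^ k) x) / fact k) sums exp_form f x"
  unfolding exp_form_def by (intro exp_form_sums_aux eigenbasis_the_eigenbasis)

lemma exp_form_eq:
  "selfadjoint f \<Longrightarrow> eigenbasis f B \<Longrightarrow> exp_form f x = (\<Sum>b\<in>B. (x \<bullet> b)\<^sup>2 * exp (b \<bullet> f b))"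
  using exp_form_sums exp_form_sums_aux sums_unique2 by blast

lemma eigenbasis_shift:
  assumes "eigenbasis f B"
  shows "eigenbasis (\<lambda>x. f x + c *\<^sub>R x) B"
  using assms eigenbasis_norm[OF assms]
  unfolding eigenbasis_def by (simp add: inner_simps) (metis scaleR_add_left)

lemma exp_form_shift:
  assumes f: "selfadjoint f"
  shows "exp_form (\<lambda>x. f x + c *\<^sub>R x) x = exp c * exp_form f x"
proof -
  define B where "B = the_eigenbasis f"
  have B: "eigenbasis f B" using eigenbasis_the_eigenbasis f by (auto simp: B_def)
  have "exp_form (\<lambda>x. f x + c *\<^sub>R x) x = (\<Sum>b\<in>B. (x \<bullet> b)\<^sup>2 * exp (b \<bullet> (f b + c *\<^sub>R b)))"
    by (intro exp_form_eq eigenbasis_shift B selfadjoint_intros f)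
  also have "\<dots> = (\<Sum>b\<in>B. exp c * ((x \<bullet> b)\<^sup>2 * exp (b \<bullet> f b)))"
    by (intro sum.cong refl) (simp add: inner_simps eigenbasis_norm[OF B] exp_add)
  finally show ?thesis by (simp add: exp_form_eq[OF f B] sum_distrib_left)
qed

section \<open>Growth under a rank-one perturbation\<close>

text \<open>Expanding the nonnegative double sum of
  \<open>(w i * w j) * ((x i - x j) * (y i - y j))\<close> gives twice the difference of the two
  sides.\<close>

lemma Chebyshev_sum_weighted:
  fixes w x y :: "'b \<Rightarrow> real"
  assumes "\<And>i. i \<in> I \<Longrightarrow> 0 \<le> w i"
    and "\<And>i j. i \<in> I \<Longrightarrow> j \<in> I \<Longrightarrow> 0 \<le> (x i - x j) * (y i - y j)"
  shows "(\<Sum>i\<in>I. w i * x i) * (\<Sum>i\<in>I. w i * y i) \<le> (\<Sum>i\<in>I. w i) * (\<Sum>i\<in>I. w i * (x i * y i))"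
proof -
  have "0 \<le> (\<Sum>i\<in>I. \<Sum>j\<in>I. (w i * w j) * ((x i - x j) * (y i - y j)))"
    using assms by (intro sum_nonneg mult_nonneg_nonneg[OF mult_nonneg_nonneg]) auto
  also have "\<dots> = (\<Sum>i\<in>I. \<Sum>j\<in>I. w j * (w i * (x i * y i))) - (\<Sum>i\<in>I. \<Sum>j\<in>I. (w i * x i) * (w j * y j))
     - (\<Sum>i\<in>I. \<Sum>j\<in>I. (w i * y i) * (w j * x j)) + (\<Sum>i\<in>I. \<Sum>j\<in>I. w i * (w j * (x j * y j)))"
    by (simp add: sum_subtractf[symmetric] sum.distrib[symmetric] algebra_simps)
  also have "\<dots> = 2 * ((\<Sum>i\<in>I. w i) * (\<Sum>i\<in>I. w i * (x i * y i)) - (\<Sum>i\<in>I. w i * x i) * (\<Sum>i\<in>I. w i * y i))"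
    by (simp add: sum_distrib_left[symmetric] sum_distrib_right[symmetric] mult.commute)
  finally show ?thesis by simp
qed

lemma rank_one_quadratic_form: "x \<bullet> rank_one w x = (w \<bullet> x)\<^sup>2"
  by (simp add: rank_one_def power2_eq_square inner_commute)

lemma selfadjoint_funpow:
  assumes f: "selfadjoint f"
  shows "selfadjoint (f ^^ k)"
proof (induction k)
  case (Suc k)
  have "linear (f ^^ Suc k)"
    using Suc f unfolding funpow.simps by (intro linear_compose) (auto simp: selfadjoint_def)
  moreover have "(f ^^ Suc k) x \<bullet> y = x \<bullet> (f ^^ Suc k) y" for x y
    by (simp add: selfadjointD[OF Suc] selfadjointD[OF f]) (simp add: funpow_swap1)
  ultimately show ?case unfolding selfadjoint_def by blast
qed (auto simp: selfadjoint_def id_def intro: linearI)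

text \<open>Each power of \<open>f + h v v\<^sup>T\<close> is compared with the same power of \<open>f + h I\<close>, by replacing the
  factors \<open>v v\<^sup>T\<close> with the identity one at a time; Chebyshev's inequality for the spectral measure
  of \<open>v\<close> shows that each replacement increases the moment.\<close>

lemma funpow_rank_one_le:
  fixes f :: "'a::euclidean_space \<Rightarrow> 'a"
  assumes f: "selfadjoint f" and B: "eigenbasis f B" and pos: "\<And>b. b \<in> B \<Longrightarrow> 0 \<le> b \<bullet> f b"
    and v: "norm v = 1" and h: "0 \<le> h"
  shows "v \<bullet> (f ^^ j) (((\<lambda>x. f x + h *\<^sub>R rank_one v x) ^^ k) v)
    \<le> (\<Sum>b\<in>B. (v \<bullet> b)\<^sup>2 * ((b \<bullet> f b) ^ j * (b \<bullet> f b + h) ^ k))"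
\<comment> \<open>\<open>j\<close> stays arbitrary: splitting off one factor leaves either a further
  \<open>f\<close> on the left, where the hypothesis is used at \<open>Suc j\<close>, or a product
  containing the moment \<open>v \<bullet> y\<close>, where it is used at 0.\<close>
proof (induction k arbitrary: j)
  case 0
  then show ?case by (simp add: funpow_quadratic_form[OF f B])
next
  case (Suc k)
  define A where "A = (\<lambda>x. f x + h *\<^sub>R rank_one v x)"
  define y where "y = (A ^^ k) v"
  have Ay: "A y = f y + (h * (v \<bullet> y)) *\<^sub>R v" by (simp add: A_def rank_one_def)
  let ?l = "\<lambda>b. b \<bullet> f b" and ?w = "\<lambda>b. (v \<bullet> b)\<^sup>2"
  have lin: "linear (f ^^ j)" using selfadjoint_funpow[OF f] by (simp add: selfadjoint_def)
  have w1: "(\<Sum>b\<in>B. ?w b) = 1" using v by (simp add: eigenbasis_sum_squares[OF B] norm_eq_1)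
  have "v \<bullet> (f ^^ j) ((A ^^ Suc k) v) = v \<bullet> (f ^^ Suc j) y + h * ((v \<bullet> y) * (v \<bullet> (f ^^ j) v))"
    by (simp add: y_def[symmetric] Ay linear_add[OF lin] linear_cmul[OF lin] inner_simps funpow_swap1)
  also have "\<dots> \<le> (\<Sum>b\<in>B. ?w b * (?l b ^ Suc j * (?l b + h) ^ k))
      + h * ((\<Sum>b\<in>B. ?w b * (?l b + h) ^ k) * (\<Sum>b\<in>B. ?w b * ?l b ^ j))"
    using Suc.IH[of "Suc j"] Suc.IH[of 0] pos h unfolding A_def[symmetric] y_def[symmetric]
    by (intro add_mono mult_left_mono)
       (auto simp: funpow_quadratic_form[OF f B] intro!: sum_nonneg mult_right_mono)
  also have "\<dots> \<le> (\<Sum>b\<in>B. ?w b * (?l b ^ Suc j * (?l b + h) ^ k))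
      + h * ((\<Sum>b\<in>B. ?w b) * (\<Sum>b\<in>B. ?w b * ((?l b + h) ^ k * ?l b ^ j)))"
  proof (intro add_mono mult_left_mono Chebyshev_sum_weighted h order_refl)
    fix a b assume a: "a \<in> B" and b: "b \<in> B"
    show "0 \<le> ((?l a + h) ^ k - (?l b + h) ^ k) * (?l a ^ j - ?l b ^ j)"
    proof (cases "?l a \<le> ?l b")
      case True
      then show ?thesis
        using pos[OF a] h by (intro mult_nonpos_nonpos) (auto intro!: power_mono)
    next
      case False
      then show ?thesis
        using pos[OF b] h by (intro mult_nonneg_nonneg) (auto intro!: power_mono)
    qed
  qed auto
  also have "\<dots> = (\<Sum>b\<in>B. ?w b * (?l b ^ j * (?l b + h) ^ Suc k))"
    unfolding w1 by (simp add: sum_distrib_left sum.distrib[symmetric] algebra_simps)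
  finally show ?case unfolding A_def .
qed

text \<open>For positive semidefinite \<open>f\<close>, comparing the exponential series term by
  term with that of f + h I gives the factor exp h. Adding \<open>c\<close> times the identity makes
  any \<open>f\<close> positive semidefinite and multiplies both sides by exp c.\<close>

lemma exp_form_rank_one_growth:
  fixes f :: "'a::euclidean_space \<Rightarrow> 'a"
  assumes f: "selfadjoint f" and v: "norm v = 1" and h: "0 \<le> h"
  shows "exp_form (\<lambda>x. f x + h *\<^sub>R rank_one v x) v \<le> exp h * exp_form f v"
proof -
  define B where "B = the_eigenbasis f"
  have B: "eigenbasis f B" using eigenbasis_the_eigenbasis f by (auto simp: B_def)
  define c where "c = (\<Sum>b\<in>B. \<bar>b \<bullet> f b\<bar>)"
  define g where "g = (\<lambda>x. f x + c *\<^sub>R x)"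
  have g: "selfadjoint g" unfolding g_def by (intro selfadjoint_intros f)
  have gB: "eigenbasis g B" unfolding g_def by (rule eigenbasis_shift[OF B])
  have pos: "0 \<le> b \<bullet> g b" if "b \<in> B" for b
  proof -
    have "\<bar>b \<bullet> f b\<bar> \<le> c"
      unfolding c_def using that finite_eigenbasis[OF B] by (intro member_le_sum) auto
    then show ?thesis by (simp add: g_def inner_simps eigenbasis_norm[OF B that])
  qed
  define A where "A = (\<lambda>x. g x + h *\<^sub>R rank_one v x)"
  define F where "F = (\<lambda>x. f x + h *\<^sub>R rank_one v x)"
  have A: "selfadjoint A" unfolding A_def by (intro selfadjoint_intros g)
  have F: "selfadjoint F" unfolding F_def by (intro selfadjoint_intros f)
  have ghS: "selfadjoint (\<lambda>x. g x + h *\<^sub>R x)" by (intro selfadjoint_intros g)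
  have "exp_form A v \<le> exp_form (\<lambda>x. g x + h *\<^sub>R x) v"
  proof (rule sums_le[OF _ exp_form_sums[OF A] exp_form_sums[OF ghS]])
    fix k
    show "v \<bullet> (A ^^ k) v / fact k \<le> v \<bullet> ((\<lambda>x. g x + h *\<^sub>R x) ^^ k) v / fact k"
      using funpow_rank_one_le[OF g gB pos v h, of 0 k]
      by (intro divide_right_mono)
         (simp_all add: A_def funpow_quadratic_form[OF ghS eigenbasis_shift[OF gB]] inner_simps
           eigenbasis_norm[OF B])
  qed
  also have "\<dots> = exp h * (exp c * exp_form f v)"
    by (simp add: exp_form_shift[OF g]) (simp add: g_def exp_form_shift[OF f])
  also have "exp_form A v = exp c * exp_form F v"
    using exp_form_shift[OF F, of c v] by (simp add: A_def F_def g_def add_ac)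
  finally show ?thesis by (simp add: F_def)
qed

section \<open>Differentiation along a rank-one direction\<close>

text \<open>Klein's inequality for the perturbation t v v^T, whose trace against e^f is
  \<open>t * exp_form f v\<close>.\<close>

lemma trexp_rank_one_tangent:
  assumes "selfadjoint f"
  shows "trexp f + t * exp_form f v \<le> trexp (\<lambda>x. f x + t *\<^sub>R rank_one v x)"
proof -
  have "trexp f + t * exp_form f v = trexp f +
      (\<Sum>b\<in>the_eigenbasis f. exp (b \<bullet> f b) * (b \<bullet> (t *\<^sub>R rank_one v b)))"
    by (simp add: exp_form_def rank_one_quadratic_form sum_distrib_left mult_ac)
  also have "\<dots> \<le> trexp (\<lambda>x. f x + t *\<^sub>R rank_one v x)"
    by (intro trexp_tangent selfadjoint_intros assms)
  finally show ?thesis .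
qed

text \<open>Let \<open>u\<close> be the claimed derivative. The tangent inequalities at
  \<open>s\<close> and \<open>t\<close> squeeze the difference quotient between \<open>u s\<close>
  and \<open>u t\<close>, so it suffices that \<open>u\<close> is continuous; this follows from
  monotonicity and the growth bound.\<close>

lemma trexp_rank_one_has_derivative:
  fixes f :: "'a::euclidean_space \<Rightarrow> 'a"
  assumes f: "selfadjoint f" and v: "norm v = 1"
  shows "((\<lambda>s. trexp (\<lambda>x. f x + s *\<^sub>R rank_one v x)) has_real_derivative
      exp_form (\<lambda>x. f x + s *\<^sub>R rank_one v x) v) (at s)"
proof -
  define F where "F = (\<lambda>s. trexp (\<lambda>x. f x + s *\<^sub>R rank_one v x))"
  define u where "u = (\<lambda>s. exp_form (\<lambda>x. f x + s *\<^sub>R rank_one v x) v)"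
  have sa: "selfadjoint (\<lambda>x. f x + s *\<^sub>R rank_one v x)" for s by (intro selfadjoint_intros f)
  have tan: "(t - s) * u s \<le> F t - F s" for s t
    using trexp_rank_one_tangent[OF sa, of s "t - s" v]
    by (simp add: F_def u_def scaleR_add_left[symmetric] add.assoc)
  have growth: "u t \<le> exp (t - s) * u s" if "s \<le> t" for s t
    using exp_form_rank_one_growth[OF sa v, of "t - s" s] that
    by (simp add: u_def scaleR_add_left[symmetric] add.assoc)
  have mono: "u s \<le> u t" if "s \<le> t" for s t
  proof (cases "s = t")
    case False
    \<comment> \<open>Adding the tangent inequalities at \<open>s\<close> and at \<open>t\<close>
      cancels the values of \<open>F\<close>.\<close>
    have "(t - s) * u s \<le> (t - s) * u t" using tan[of t s] tan[of s t] by (simp add: algebra_simps)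
    then show ?thesis using that False by simp
  qed simp
  have lim: "(u \<longlongrightarrow> u s) (at s)"
  proof (rule tendsto_sandwich)
    show "\<forall>\<^sub>F t in at s. exp (- \<bar>t - s\<bar>) * u s \<le> u t"
    proof (intro always_eventually allI)
      fix t
      show "exp (- \<bar>t - s\<bar>) * u s \<le> u t"
      proof (cases "s \<le> t")
        case True
        have "exp (- \<bar>t - s\<bar>) * u s \<le> 1 * u s"
          by (intro mult_right_mono) (auto simp: u_def exp_form_nonneg)
        with mono[OF True] show ?thesis by simp
      next
        case False
        then show ?thesis using growth[of t s] by (simp add: exp_diff exp_minus field_simps)
      qed
    qed
    show "\<forall>\<^sub>F t in at s. u t \<le> exp \<bar>t - s\<bar> * u s"
    proof (intro always_eventually allI)
      fix t
      show "u t \<le> exp \<bar>t - s\<bar> * u s"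
      proof (cases "s \<le> t")
        case True
        then show ?thesis using growth[of s t] by simp
      next
        case False
        have "1 * u s \<le> exp \<bar>t - s\<bar> * u s"
          by (intro mult_right_mono) (auto simp: u_def exp_form_nonneg)
        with mono[of t s] False show ?thesis by simp
      qed
    qed
    show "((\<lambda>t. exp (- \<bar>t - s\<bar>) * u s) \<longlongrightarrow> u s) (at s)"
      by (auto intro!: tendsto_eq_intros)
    show "((\<lambda>t. exp \<bar>t - s\<bar> * u s) \<longlongrightarrow> u s) (at s)"
      by (auto intro!: tendsto_eq_intros)
  qed
  have "((\<lambda>t. (F t - F s) / (t - s)) \<longlongrightarrow> u s) (at s)"
  proof (rule Lim_transform2[OF lim], rule Lim_null_comparison)
    show "\<forall>\<^sub>F t in at s. norm (u t - (F t - F s) / (t - s)) \<le> \<bar>u t - u s\<bar>"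
    proof (rule eventually_at_filter[THEN iffD2], intro always_eventually allI impI)
      fix t assume "t \<noteq> s"
      have a: "(t - s) * u s \<le> F t - F s" "F t - F s \<le> (t - s) * u t"
        using tan[of t s] tan[of s t] by (auto simp: algebra_simps)
      define q where "q = (F t - F s) / (t - s)"
      have q: "F t - F s = (t - s) * q" using \<open>t \<noteq> s\<close> by (simp add: q_def)
      show "norm (u t - (F t - F s) / (t - s)) \<le> \<bar>u t - u s\<bar>"
        using a \<open>t \<noteq> s\<close> unfolding q_def[symmetric] q
        by (cases "s < t") (auto simp: mult_le_cancel_left)
    qed
    show "((\<lambda>t. \<bar>u t - u s\<bar>) \<longlongrightarrow> 0) (at s)"
      using tendsto_rabs[OF LIM_zero[OF lim]] by simp
  qed
  then show ?thesis by (simp add: has_field_derivative_iff F_def u_def)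
qed

text \<open>The Golden--Thompson inequality for a rank-one summand, as concavity of
  \<open>s \<mapsto> tr exp (f + ln s v v\<^sup>T)\<close>.\<close>

lemma trexp_add_unit_rank_one_le:
  fixes f :: "'a::euclidean_space \<Rightarrow> 'a"
  assumes f: "selfadjoint f" and v: "norm v = 1"
  shows "trexp (\<lambda>x. f x + b *\<^sub>R rank_one v x) \<le> trexp f + (exp b - 1) * exp_form f v"
proof -
  define F where "F = (\<lambda>s. trexp (\<lambda>x. f x + s *\<^sub>R rank_one v x))"
  define u where "u = (\<lambda>s. exp_form (\<lambda>x. f x + s *\<^sub>R rank_one v x) v)"
  \<comment> \<open>The growth bound gives u s \<le> e^s u 0 for s \<ge> 0 and the reverse for s
    \<le> 0. Hence \<phi> is maximal at 0, which covers \<open>b\<close> of either sign.\<close>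
  define \<phi> where "\<phi> = (\<lambda>s. F s - exp s * u 0)"
  have sa: "selfadjoint (\<lambda>x. f x + s *\<^sub>R rank_one v x)" for s by (intro selfadjoint_intros f)
  have growth: "u t \<le> exp (t - s) * u s" if "s \<le> t" for s t
    using exp_form_rank_one_growth[OF sa v, of "t - s" s] that
    by (simp add: u_def scaleR_add_left[symmetric] add.assoc)
  have der: "(\<phi> has_real_derivative (u s - exp s * u 0)) (at s)" for s
    unfolding \<phi>_def F_def
    by (auto intro!: derivative_eq_intros trexp_rank_one_has_derivative[OF f v] simp: u_def)
  have "\<phi> b \<le> \<phi> 0"
  proof (cases "0 \<le> b")
    case True
    show ?thesis
    proof (rule DERIV_nonpos_imp_nonincreasing[OF True])
      fix s :: real assume "0 \<le> s"
      then show "\<exists>y. DERIV \<phi> s :> y \<and> y \<le> 0"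
        using der[of s] growth[of 0 s] by auto
    qed
  next
    case False
    then have "b \<le> 0" by simp
    then show ?thesis
    proof (rule DERIV_nonneg_imp_nondecreasing)
      fix s :: real assume "s \<le> 0"
      then have "exp s * u 0 \<le> u s"
        using growth[of s 0] by (simp add: exp_minus field_simps)
      then show "\<exists>y. DERIV \<phi> s :> y \<and> 0 \<le> y"
        using der[of s] by auto
    qed
  qed
  then show ?thesis by (simp add: \<phi>_def F_def u_def algebra_simps)
qed

section \<open>Rank-one summands of bounded norm\<close>

text \<open>Convexity: on [0, L] the function exp (b s) lies below the chord through its endpoints,
  for \<open>b\<close> of either sign.\<close>

lemma exp_chord_le:
  fixes b s L :: real
  assumes "0 \<le> s" "s \<le> L" "0 < L"
  shows "exp (b * s) - 1 \<le> s * ((exp (b * L) - 1) / L)"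
proof -
  have "exp ((1 - s / L) *\<^sub>R 0 + (s / L) *\<^sub>R (b * L)) \<le> (1 - s / L) * exp 0 + (s / L) * exp (b * L)"
    using assms by (intro convex_onD[OF exp_convex]) auto
  moreover have "(1 - s / L) *\<^sub>R 0 + (s / L) *\<^sub>R (b * L) = b * s" using assms by simp
  ultimately have "exp (b * s) \<le> (1 - s / L) + (s / L) * exp (b * L)" by simp
  then show ?thesis by (simp add: algebra_simps diff_divide_distrib)
qed

text \<open>With \<open>v\<close> the unit vector along \<open>w\<close>, the bound for unit vectors
  applies with \<open>b * (norm w)\<^sup>2\<close>. The chord makes its coefficient linear in
  \<open>(norm w)\<^sup>2\<close>, and this factor turns v^T e^f v into w^T e^f w. The result is
  linear in w w^T and so can be averaged.\<close>

lemma trexp_add_rank_one_le: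
  fixes f :: "'a::euclidean_space \<Rightarrow> 'a"
  assumes f: "selfadjoint f" and L: "(norm w)\<^sup>2 \<le> L" "0 < L"
  shows "trexp (\<lambda>x. f x + b *\<^sub>R rank_one w x) \<le> trexp f + (exp (b * L) - 1) / L * exp_form f w"
proof (cases "w = 0")
  case True
  then show ?thesis by (simp add: rank_one_def exp_form_def)
next
  case False
  define v where "v = w /\<^sub>R norm w"
  have v: "norm v = 1" and w: "w = norm w *\<^sub>R v" using False by (auto simp: v_def)
  have "rank_one w x = (norm w)\<^sup>2 *\<^sub>R rank_one v x" for x
    by (subst w) (simp add: rank_one_def power2_eq_square)
  then have "trexp (\<lambda>x. f x + b *\<^sub>R rank_one w x) = trexp (\<lambda>x. f x + (b * (norm w)\<^sup>2) *\<^sub>R rank_one v x)"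
    by simp
  also have "\<dots> \<le> trexp f + (exp (b * (norm w)\<^sup>2) - 1) * exp_form f v"
    by (rule trexp_add_unit_rank_one_le[OF f v])
  also have "\<dots> \<le> trexp f + ((norm w)\<^sup>2 * ((exp (b * L) - 1) / L)) * exp_form f v"
    using L by (intro add_left_mono mult_right_mono exp_chord_le exp_form_nonneg) auto
  also have "(norm w)\<^sup>2 * exp_form f v = exp_form f w"
    by (subst (2) w) (simp add: exp_form_def sum_distrib_left power_mult_distrib mult_ac)
  then have "((norm w)\<^sup>2 * ((exp (b * L) - 1) / L)) * exp_form f v = (exp (b * L) - 1) / L * exp_form f w"
    by (metis (no_types) mult.assoc mult.commute)
  finally show ?thesis .
qed

text \<open>Golden--Thompson followed by Klein's inequality. Lieb's concavity theorem would give
  \<open>ln (E e\<^sup>X)\<close> in place of \<open>E e\<^sup>X - I\<close>, a gain that the bound \<open>\<delta>\<close> does not use.\<close>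

lemma expectation_trexp_rank_one_le:
  fixes f K :: "'a::euclidean_space \<Rightarrow> 'a" and w :: "'k \<Rightarrow> 'a"
  assumes f: "selfadjoint f" and K: "selfadjoint K" and fin: "finite (set_pmf p)"
    and L: "\<And>k. k \<in> set_pmf p \<Longrightarrow> (norm (w k))\<^sup>2 \<le> L" "0 < L"
    and le: "\<And>x. (exp (b * L) - 1) / L * measure_pmf.expectation p (\<lambda>k. (w k \<bullet> x)\<^sup>2) \<le> x \<bullet> K x"
  shows "measure_pmf.expectation p (\<lambda>k. trexp (\<lambda>x. f x + b *\<^sub>R rank_one (w k) x))
    \<le> trexp (\<lambda>x. f x + K x)"
proof -
  define g where "g = (exp (b * L) - 1) / L"
  note int = integrable_measure_pmf_finite[OF fin]
  have "measure_pmf.expectation p (\<lambda>k. trexp (\<lambda>x. f x + b *\<^sub>R rank_one (w k) x))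
      \<le> measure_pmf.expectation p (\<lambda>k. trexp f + g * exp_form f (w k))"
    unfolding g_def by (intro integral_mono_AE int AE_pmfI trexp_add_rank_one_le f L)
  \<comment> \<open>The mean of w^T e^f w depends on \<open>w\<close> only through E (w w^T), here
    read off on the eigenbasis of \<open>f\<close>.\<close>
  also have "\<dots> = trexp f + (\<Sum>b\<in>the_eigenbasis f. exp (b \<bullet> f b) *
      (g * measure_pmf.expectation p (\<lambda>k. (w k \<bullet> b)\<^sup>2)))"
    by (simp add: exp_form_def int sum_distrib_left mult_ac)
  also have "\<dots> \<le> trexp f + (\<Sum>b\<in>the_eigenbasis f. exp (b \<bullet> f b) * (b \<bullet> K b))"
    unfolding g_def using le by (intro add_left_mono sum_mono mult_left_mono) auto
  also have "\<dots> \<le> trexp (\<lambda>x. f x + K x)" by (rule trexp_tangent[OF f K])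
  finally show ?thesis .
qed

subsection \<open>Moment generating functions of random sums\<close>

lemma expectation_bind_pmf_finite:
  fixes h :: "'b \<Rightarrow> real"
  assumes "finite (set_pmf p)" "\<And>a. a \<in> set_pmf p \<Longrightarrow> finite (set_pmf (f a))"
  shows "measure_pmf.expectation (bind_pmf p f) h
    = measure_pmf.expectation p (\<lambda>a. measure_pmf.expectation (f a) h)"
  using assms
  by (subst pmf_expectation_bind[of "set_pmf p"]) (auto simp: integral_measure_pmf[of "set_pmf p"])

lemma expectation_mono_finite:
  fixes g h :: "'b \<Rightarrow> real"
  assumes "finite (set_pmf p)" "\<And>a. a \<in> set_pmf p \<Longrightarrow> g a \<le> h a"
  shows "measure_pmf.expectation p g \<le> measure_pmf.expectation p h"
  using assms by (intro integral_mono_AE integrable_measure_pmf_finite AE_pmfI)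

lemma finite_set_Pi_pmf:
  assumes "finite I" "\<And>i. i \<in> I \<Longrightarrow> finite (set_pmf (p i))"
  shows "finite (set_pmf (Pi_pmf I d p))"
proof (rule finite_subset[OF set_Pi_pmf_subset'[OF assms(1)]])
  show "finite (PiE_dflt I d (set_pmf \<circ> p))"
    using assms by (intro finite_PiE_dflt) auto
qed

text \<open>Induction over the coordinates, for arbitrary \<open>f\<close>. With coordinate
  \<open>i\<close> fixed, its term is absorbed into \<open>f\<close> and the hypothesis averages the
  others; coordinate \<open>i\<close> is then averaged with \<open>f\<close> plus the remaining
  \<open>K\<close> as the fixed part.\<close>

lemma expectation_trexp_Pi_pmf_le:
  fixes f :: "'a::euclidean_space \<Rightarrow> 'a" and w :: "'i \<Rightarrow> 'k \<Rightarrow> 'a"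
  assumes "finite I" and f: "selfadjoint f" and "0 < L"
    and "\<And>i. i \<in> I \<Longrightarrow> finite (set_pmf (p i))"
    and "\<And>i. i \<in> I \<Longrightarrow> selfadjoint (K i)"
    and "\<And>i k. i \<in> I \<Longrightarrow> k \<in> set_pmf (p i) \<Longrightarrow> (norm (w i k))\<^sup>2 \<le> L"
    and "\<And>i x. i \<in> I \<Longrightarrow>
      (exp (b * L) - 1) / L * measure_pmf.expectation (p i) (\<lambda>k. (w i k \<bullet> x)\<^sup>2) \<le> x \<bullet> K i x"
  shows "measure_pmf.expectation (Pi_pmf I d p)
      (\<lambda>k. trexp (\<lambda>x. f x + b *\<^sub>R (\<Sum>i\<in>I. rank_one (w i (k i)) x)))
    \<le> trexp (\<lambda>x. f x + (\<Sum>i\<in>I. K i x))"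
  using assms(1) f assms(4-)
proof (induction I arbitrary: f rule: finite_induct)
  case empty
  then show ?case by simp
next
  case (insert i I)
  note f = insert.prems(1)
  let ?E = "measure_pmf.expectation"
  let ?S = "\<lambda>k x. \<Sum>i\<in>I. rank_one (w i (k i)) x"
  have finI: "finite (set_pmf (Pi_pmf I d p))" and fini: "finite (set_pmf (p i))"
    using insert by (auto intro!: finite_set_Pi_pmf)
  have SK: "selfadjoint (\<lambda>x. f x + (\<Sum>i\<in>I. K i x))"
    using insert by (intro selfadjoint_intros) auto
  have upd: "?S (k(i := y)) = ?S k" for k y
    using insert.hyps by (auto intro!: sum.cong)
  have "?E (Pi_pmf (insert i I) d p)
      (\<lambda>k. trexp (\<lambda>x. f x + b *\<^sub>R (\<Sum>i\<in>insert i I. rank_one (w i (k i)) x)))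
    = ?E (p i) (\<lambda>y. ?E (Pi_pmf I d p) (\<lambda>k.
        trexp (\<lambda>x. (f x + b *\<^sub>R rank_one (w i y) x) + b *\<^sub>R ?S k x)))"
    using insert.hyps finI fini
    by (simp add: Pi_pmf_insert' expectation_bind_pmf_finite upd[THEN fun_cong] algebra_simps
        del: fun_upd_apply) (simp add: add_ac)
  also have "\<dots> \<le> ?E (p i) (\<lambda>y. trexp (\<lambda>x. (f x + b *\<^sub>R rank_one (w i y) x) + (\<Sum>i\<in>I. K i x)))"
    using insert.prems by (intro expectation_mono_finite fini insert.IH selfadjoint_intros f) auto
  also have "\<dots> = ?E (p i) (\<lambda>y. trexp (\<lambda>x. (f x + (\<Sum>i\<in>I. K i x)) + b *\<^sub>R rank_one (w i y) x))"
    by (simp add: add_ac)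
  also have "\<dots> \<le> trexp (\<lambda>x. (f x + (\<Sum>i\<in>I. K i x)) + K i x)"
    using insert.prems fini \<open>0 < L\<close> by (intro expectation_trexp_rank_one_le[OF SK, where L = L]) auto
  also have "\<dots> = trexp (\<lambda>x. f x + (\<Sum>i\<in>insert i I. K i x))"
    using insert.hyps by (simp add: add_ac)
  finally show ?case .
qed

section \<open>Sampling without replacement\<close>

text \<open>With G = e^B - 1 the claim is 1 + G \<le> (1 + (1 - p) G) e^(p G). The product (1 + (1 -
  p) G) (1 + p G) exceeds 1 + G by p (1 - p) G^2, and 1 + p G \<le> e^(p G). It controls the reduced
  coefficient with which the first draw enters below.\<close>

lemma exp_diff_chord_le:
  fixes B p :: real
  assumes "0 \<le> p" "p \<le> 1"
  shows "exp (B - p * (exp B - 1)) - 1 \<le> (1 - p) * (exp B - 1)"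
proof -
  define G where "G = exp B - 1"
  have G: "- 1 < G" "exp B = 1 + G" by (auto simp: G_def)
  \<comment> \<open>This sign permits multiplication by 1 + p G \<le> e^(p G). For negative
    \<open>B\<close> it rests on -1 < G < 0.\<close>
  have nn: "0 \<le> 1 + (1 - p) * G"
  proof (cases "0 \<le> G")
    case False
    then have "(1 - p) * (- G) \<le> 1 * 1" using assms G by (intro mult_mono) auto
    then show ?thesis by simp
  qed (use assms in auto)
  have "1 + G \<le> (1 + (1 - p) * G) * (1 + p * G)"
  proof -
    have "(1 + (1 - p) * G) * (1 + p * G) = 1 + G + p * (1 - p) * G\<^sup>2"
      by (simp add: algebra_simps power2_eq_square)
    then show ?thesis using assms by simp
  qed
  also have "\<dots> \<le> (1 + (1 - p) * G) * exp (p * G)"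
    by (intro mult_left_mono nn exp_ge_add_one_self)
  finally have "exp B / exp (p * G) \<le> 1 + (1 - p) * G"
    by (simp add: G divide_le_eq)
  then show ?thesis by (simp add: exp_diff G_def[symmetric])
qed

text \<open>Conditioning on the first draw \<open>y\<close> and applying the induction hypothesis to \<open>U - {y}\<close> leaves
  a multiple of \<open>\<Sum>\<^bsub>t \<in> U\<^esub> w t (w t)\<^sup>T\<close>, so that the first draw enters through a single rank-one term.\<close>

lemma expectation_trexp_permutation_le:
  fixes f :: "'a::euclidean_space \<Rightarrow> 'a" and w :: "'m \<Rightarrow> 'a"
  assumes "finite U" "j \<le> card U" and f: "selfadjoint f" and L: "0 < L"
    and "\<And>t. t \<in> U \<Longrightarrow> (norm (w t))\<^sup>2 \<le> L"
  shows "measure_pmf.expectation (pmf_of_set (permutations_of_set U))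
      (\<lambda>ks. trexp (\<lambda>x. f x + b *\<^sub>R (\<Sum>i<j. rank_one (w (ks ! i)) x)))
    \<le> trexp (\<lambda>x. f x + (real j / real (card U) * ((exp (b * L) - 1) / L)) *\<^sub>R (\<Sum>t\<in>U. rank_one (w t) x))"
  using assms(1-3,5)
proof (induction j arbitrary: U f)
  case 0
  then show ?case by simp
next
  case (Suc j)
  note fin = \<open>finite U\<close> and f = \<open>selfadjoint f\<close>
  let ?E = "measure_pmf.expectation"
  define g where "g = (exp (b * L) - 1) / L"
  define M where "M = real (card U)"
  \<comment> \<open>From the \<open>M - 1\<close> remaining indices \<open>j\<close> more are drawn,
    so \<open>p\<close> is the chance that a given one is among them. For \<open>M = 1\<close> also
    j = 0, and the quotient is 0 by convention.\<close>
  define p where "p = real j / (M - 1)"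
  define T where "T = (\<lambda>x. \<Sum>t\<in>U. rank_one (w t) x)"
  have ne: "U \<noteq> {}" using Suc.prems by auto
  have M: "1 \<le> M" "real j \<le> M - 1" using Suc.prems by (auto simp: M_def)
  have p: "0 \<le> p" "p \<le> 1" using M by (auto simp: p_def divide_le_eq)
  have T: "selfadjoint T" unfolding T_def by (intro selfadjoint_intros)
  have card: "real (card (U - {y})) = M - 1" if "y \<in> U" for y
    using that fin M by (simp add: M_def)
  \<comment> \<open>A uniform permutation is a uniform first entry \<open>y\<close> followed by a
    uniform permutation of the rest; entry i + 1 of the whole is entry i of the rest.\<close>
  have "?E (pmf_of_set (permutations_of_set U))
      (\<lambda>ks. trexp (\<lambda>x. f x + b *\<^sub>R (\<Sum>i<Suc j. rank_one (w (ks ! i)) x)))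
    = ?E (pmf_of_set U) (\<lambda>y. ?E (pmf_of_set (permutations_of_set (U - {y})))
        (\<lambda>ks. trexp (\<lambda>x. (f x + b *\<^sub>R rank_one (w y) x) + b *\<^sub>R (\<Sum>i<j. rank_one (w (ks ! i)) x))))"
    using fin ne
    by (simp add: random_permutation_of_set expectation_bind_pmf_finite sum.lessThan_Suc_shift
        scaleR_add_right add.assoc del: sum.lessThan_Suc)
  also have "\<dots> \<le> ?E (pmf_of_set U) (\<lambda>y. trexp (\<lambda>x. (f x + b *\<^sub>R rank_one (w y) x) +
      (p * g) *\<^sub>R (\<Sum>t\<in>U - {y}. rank_one (w t) x)))"
  proof (rule expectation_mono_finite)
    show "finite (set_pmf (pmf_of_set U))" using fin ne by simp
    fix y assume "y \<in> set_pmf (pmf_of_set U)"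
    then have y: "y \<in> U" using fin ne by simp
    show "?E (pmf_of_set (permutations_of_set (U - {y})))
        (\<lambda>ks. trexp (\<lambda>x. (f x + b *\<^sub>R rank_one (w y) x) + b *\<^sub>R (\<Sum>i<j. rank_one (w (ks ! i)) x)))
      \<le> trexp (\<lambda>x. (f x + b *\<^sub>R rank_one (w y) x) + (p * g) *\<^sub>R (\<Sum>t\<in>U - {y}. rank_one (w t) x))"
      unfolding p_def g_def card[OF y, symmetric]
      using Suc.prems y by (intro Suc.IH selfadjoint_intros f) auto
  qed
  also have "\<dots> = ?E (pmf_of_set U) (\<lambda>y. trexp (\<lambda>x. (f x + (p * g) *\<^sub>R T x) + (b - p * g) *\<^sub>R rank_one (w y) x))"
  proof (intro Bochner_Integration.integral_cong_AE AE_pmfI)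
    fix y assume "y \<in> set_pmf (pmf_of_set U)"
    then have y: "y \<in> U" using fin ne by simp
    have "(\<lambda>x. (f x + b *\<^sub>R rank_one (w y) x) + (p * g) *\<^sub>R (\<Sum>t\<in>U - {y}. rank_one (w t) x))
      = (\<lambda>x. (f x + (p * g) *\<^sub>R T x) + (b - p * g) *\<^sub>R rank_one (w y) x)"
      using y fin by (auto simp: T_def sum_diff1 algebra_simps)
    then show "trexp (\<lambda>x. (f x + b *\<^sub>R rank_one (w y) x) + (p * g) *\<^sub>R (\<Sum>t\<in>U - {y}. rank_one (w t) x))
      = trexp (\<lambda>x. (f x + (p * g) *\<^sub>R T x) + (b - p * g) *\<^sub>R rank_one (w y) x)" by simp
  qed auto
  also have "\<dots> \<le> trexp (\<lambda>x. (f x + (p * g) *\<^sub>R T x) + ((1 - p) / M * g) *\<^sub>R T x)"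
  proof (rule expectation_trexp_rank_one_le)
    show "selfadjoint (\<lambda>x. f x + (p * g) *\<^sub>R T x)" "selfadjoint (\<lambda>x. ((1 - p) / M * g) *\<^sub>R T x)"
      by (intro selfadjoint_intros f T)+
    show "finite (set_pmf (pmf_of_set U))" using fin ne by simp
    show "(norm (w y))\<^sup>2 \<le> L" if "y \<in> set_pmf (pmf_of_set U)" for y
      using that fin ne Suc.prems by simp
    show "0 < L" by (rule L)
    fix x :: 'a
    have Tx: "x \<bullet> T x = (\<Sum>t\<in>U. (w t \<bullet> x)\<^sup>2)"
      by (simp add: T_def inner_sum_right rank_one_quadratic_form)
    \<comment> \<open>Since g L = e^(b L) - 1, the exponent (b - p g) L has the form B - p (e^B - 1)
      with B = b L.\<close>
    have "exp ((b - p * g) * L) - 1 \<le> (1 - p) * (exp (b * L) - 1)"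
    proof -
      have "g * L = exp (b * L) - 1" using L by (simp add: g_def)
      then have "(b - p * g) * L = b * L - p * (exp (b * L) - 1)"
        by (metis left_diff_distrib mult.assoc)
      then show ?thesis using exp_diff_chord_le[OF p, of "b * L"] by simp
    qed
    then have "(exp ((b - p * g) * L) - 1) / L \<le> (1 - p) * g"
      using L by (simp add: g_def divide_right_mono)
    then have "(exp ((b - p * g) * L) - 1) / L * ((x \<bullet> T x) / M) \<le> (1 - p) * g * ((x \<bullet> T x) / M)"
      by (intro mult_right_mono divide_nonneg_nonneg) (auto simp: Tx M_def intro: sum_nonneg)
    then show "(exp ((b - p * g) * L) - 1) / L * ?E (pmf_of_set U) (\<lambda>k. (w k \<bullet> x)\<^sup>2)
        \<le> x \<bullet> ((1 - p) / M * g) *\<^sub>R T x"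
      using fin ne by (simp add: integral_pmf_of_set Tx M_def)
  qed
  also have "(\<lambda>x. (f x + (p * g) *\<^sub>R T x) + ((1 - p) / M * g) *\<^sub>R T x)
     = (\<lambda>x. f x + (real (Suc j) / M * g) *\<^sub>R T x)"
  proof
    fix x
    \<comment> \<open>From p (M - 1) = j follows p M + 1 - p = j + 1, the coefficient that closes
      the induction. For \<open>M = 1\<close> that equation does not determine \<open>p\<close>, and
      its value 0 is used.\<close>
    have "p + (1 - p) / M = real (Suc j) / M"
    proof (cases "M = 1")
      case True
      then show ?thesis using M by (simp add: p_def)
    next
      case False
      then have "p * (M - 1) = real j" by (simp add: p_def)
      then show ?thesis using M by (simp add: field_simps)
    qed
    then have "p * g + (1 - p) / M * g = real (Suc j) / M * g" by (metis distrib_right)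
    then show "(f x + (p * g) *\<^sub>R T x) + ((1 - p) / M * g) *\<^sub>R T x = f x + (real (Suc j) / M * g) *\<^sub>R T x"
      by (metis add.assoc scaleR_add_left)
  qed
  finally show ?case by (simp add: M_def g_def T_def)
qed

section \<open>Chernoff tails of the quadratic form\<close>

lemma trexp_scaleR:
  "trexp (\<lambda>x::'a::euclidean_space. c *\<^sub>R x) = real DIM('a) * exp c"
proof -
  define B :: "'a set" where "B = the_eigenbasis (\<lambda>x. c *\<^sub>R x)"
  have B: "eigenbasis (\<lambda>x::'a. c *\<^sub>R x) B"
    unfolding B_def by (intro eigenbasis_the_eigenbasis selfadjoint_intros)
  show ?thesis
    by (simp add: trexp_def B_def[symmetric] eigenbasis_norm[OF B] eigenbasis_card[OF B])
qed

lemma trexp_nonneg: "0 \<le> trexp f"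
  by (auto simp: trexp_def intro!: sum_nonneg)

lemma chernoff_f_powr:
  assumes "-1 < x"
  shows "chernoff_f x powr a = exp (a * (x - (1 + x) * ln (1 + x)))"
  using assms by (simp add: chernoff_f_def powr_def ln_mult exp_add[symmetric] algebra_simps)

text \<open>Markov's inequality for the trace exponential. \<open>b\<close> has the sign of \<eta>,
  so the factor \<open>b\<close> in the event expresses the upper tail for positive \<eta> and the
  lower tail for negative \<eta>. This \<open>b\<close> minimises the exponent (e^(b L) - 1) / L - b
  (1 + \<eta>).\<close>

lemma prob_quadratic_form_tail:
  fixes A :: "'w \<Rightarrow> 'a::euclidean_space \<Rightarrow> 'a"
  assumes fin: "finite (set_pmf P)" and A: "\<And>\<omega>. selfadjoint (A \<omega>)" and "0 < L" and \<eta>: "-1 < \<eta>"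
    and b: "b = ln (1 + \<eta>) / L"
    and mgf: "measure_pmf.expectation P (\<lambda>\<omega>. trexp (\<lambda>x. b *\<^sub>R A \<omega> x))
      \<le> real DIM('a) * exp ((exp (b * L) - 1) / L)"
  shows "measure_pmf.prob P {\<omega>. \<exists>x. norm x = 1 \<and> b * (1 + \<eta>) < b * (x \<bullet> A \<omega> x)}
    \<le> real DIM('a) * chernoff_f \<eta> powr (1 / L)"
proof -
  define D where "D = {\<omega>. \<exists>x. norm x = 1 \<and> b * (1 + \<eta>) < b * (x \<bullet> A \<omega> x)}"
  have "indicator D \<omega> \<le> trexp (\<lambda>x. b *\<^sub>R A \<omega> x) / exp (b * (1 + \<eta>))" for \<omega>
  proof (cases "\<omega> \<in> D")
    case True
    then obtain x where x: "norm x = 1" "b * (1 + \<eta>) < b * (x \<bullet> A \<omega> x)" by (auto simp: D_def)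
    have "exp (b * (1 + \<eta>)) \<le> exp (x \<bullet> (b *\<^sub>R A \<omega> x))" using x by simp
    also have "\<dots> \<le> trexp (\<lambda>x. b *\<^sub>R A \<omega> x)"
      by (intro exp_quadratic_form_le_trexp[of "\<lambda>x. b *\<^sub>R A \<omega> x"] x(1) selfadjoint_intros A)
    finally show ?thesis using True by simp
  qed (simp add: trexp_nonneg)
  then have "measure_pmf.expectation P (indicator D)
      \<le> measure_pmf.expectation P (\<lambda>\<omega>. trexp (\<lambda>x. b *\<^sub>R A \<omega> x) / exp (b * (1 + \<eta>)))"
    by (intro expectation_mono_finite fin) auto
  also have "\<dots> \<le> real DIM('a) * exp ((exp (b * L) - 1) / L) / exp (b * (1 + \<eta>))"
    using mgf by (simp add: divide_right_mono)
  also have "\<dots> = real DIM('a) * exp (\<eta> / L - b * (1 + \<eta>))"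
    using \<eta> \<open>0 < L\<close> by (simp add: b exp_diff)
  also have "\<eta> / L - b * (1 + \<eta>) = 1 / L * (\<eta> - (1 + \<eta>) * ln (1 + \<eta>))"
    by (simp add: b diff_divide_distrib mult.commute)
  finally show ?thesis
    using \<eta> by (simp add: D_def[symmetric] chernoff_f_powr)
qed

subsection \<open>Condition numbers of sampled matrices\<close>

text \<open>The squared singular values lie in [a, b]. The lower bound makes the kernel trivial and
  also bounds the pseudoinverse X: as Z X is an orthogonal projection, a |X y|^2 \<le> |Z X y|^2
  \<le> |y|^2.\<close>

lemma full_rank_cond2_le:
  fixes Z :: "real^'n^'m"
  assumes lower: "\<And>x. a * (norm x)\<^sup>2 \<le> (norm (Z *v x))\<^sup>2"
    and upper: "\<And>x. (norm (Z *v x))\<^sup>2 \<le> b * (norm x)\<^sup>2"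
    and a: "0 < a" and b: "0 \<le> b"
  shows "rank Z = CARD('n) \<and> cond2 Z \<le> sqrt (b / a)"
proof
  have "x = 0" if "Z *v x = 0" for x
    using lower[of x] that a by (simp add: mult_le_0_iff)
  then have "inj ((*v) Z)"
    using linear_injective_0[OF matrix_vector_mul_linear[of Z]] by blast
  then show rank: "rank Z = CARD('n)" by (simp add: full_rank_injective)
  define X where "X = moore_penrose Z"
  have X: "is_moore_penrose Z X"
    unfolding X_def by (rule is_moore_penrose_full_column_rank[OF rank])
  have Z_le: "mat_norm2 Z \<le> sqrt b"
    unfolding mat_norm2_def
  proof (rule onorm_le)
    fix x
    have "norm (Z *v x) = sqrt ((norm (Z *v x))\<^sup>2)" by simp
    also have "\<dots> \<le> sqrt (b * (norm x)\<^sup>2)" using upper by (rule real_sqrt_le_mono)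
    finally show "norm (Z *v x) \<le> sqrt b * norm x" by (simp add: real_sqrt_mult)
  qed
  \<comment> \<open>Z X is idempotent and symmetric by the Penrose equations, so Cauchy-Schwarz
    makes it a contraction.\<close>
  have proj: "norm (Z *v (X *v y)) \<le> norm y" for y
  proof -
    let ?z = "Z *v (X *v y)"
    have idem: "(Z ** X) *v ?z = ?z"
      using X by (simp add: is_moore_penrose_def matrix_vector_mul_assoc matrix_mul_assoc)
    have "?z \<bullet> ?z = ((Z ** X) *v y) \<bullet> ?z" by (simp add: matrix_vector_mul_assoc)
    also have "\<dots> = y \<bullet> (transpose (Z ** X) *v ?z)"
      by (metis dot_lmul_matrix inner_commute transpose_matrix_vector transpose_transpose)
    also have "\<dots> = y \<bullet> ?z" using X idem by (simp add: is_moore_penrose_def)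
    also have "\<dots> \<le> norm y * norm ?z" by (rule norm_cauchy_schwarz)
    finally have "norm ?z * norm ?z \<le> norm y * norm ?z"
      by (simp add: power2_norm_eq_inner[symmetric] power2_eq_square)
    then show ?thesis by (cases "?z = 0") (simp_all add: mult_le_cancel_right)
  qed
  have X_le: "mat_norm2 X \<le> 1 / sqrt a"
    unfolding mat_norm2_def
  proof (rule onorm_le)
    fix y
    have "a * (norm (X *v y))\<^sup>2 \<le> (norm y)\<^sup>2"
      by (rule order_trans[OF lower power_mono[OF proj norm_ge_zero]])
    then have "sqrt (a * (norm (X *v y))\<^sup>2) \<le> sqrt ((norm y)\<^sup>2)" by (rule real_sqrt_le_mono)
    then show "norm (X *v y) \<le> 1 / sqrt a * norm y"
      using a by (simp add: real_sqrt_mult field_simps)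
  qed
  have "cond2 Z \<le> sqrt b * (1 / sqrt a)"
    unfolding cond2_def X_def[symmetric]
    using b by (intro mult_mono Z_le X_le)
      (auto simp: mat_norm2_def intro!: onorm_pos_le matrix_vector_mul_bounded_linear)
  then show "cond2 Z \<le> sqrt (b / a)" by (simp add: real_sqrt_divide)
qed

lemma norm_matrix_vector_mult_power2:
  fixes Z :: "real^'n^'m"
  shows "(norm (Z *v x))\<^sup>2 = (\<Sum>i\<in>UNIV. (Z $ i \<bullet> x)\<^sup>2)"
  unfolding power2_norm_eq_inner
  by (subst inner_vec_def) (simp add: matrix_vector_mul_component power2_eq_square)

lemma norm_power2_rank_one:
  fixes Z :: "real^'n^'m"
  shows "(norm (Z *v x))\<^sup>2 = x \<bullet> (\<Sum>i\<in>UNIV. rank_one (Z $ i) x)"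
  by (simp add: norm_matrix_vector_mult_power2 inner_sum_right rank_one_quadratic_form)

text \<open>Union bound over the two tails: outside both, the quadratic form lies in
  [1 - \<epsilon>, 1 + \<epsilon>] on the unit sphere, and scaling extends this to all vectors. The
  moment bound is assumed for all \<open>b\<close> because the tails use one positive and one
  negative value.\<close>

lemma prob_cond2_le:
  fixes P :: "'w pmf" and Z :: "'w \<Rightarrow> real^'n^'k"
  assumes fin: "finite (set_pmf P)" and L: "0 < L" and \<epsilon>: "0 < \<epsilon>" "\<epsilon> < 1"
    and mgf: "\<And>b. measure_pmf.expectation P (\<lambda>\<omega>. trexp (\<lambda>x. b *\<^sub>R (\<Sum>i\<in>UNIV. rank_one (Z \<omega> $ i) x)))
      \<le> real CARD('n) * exp ((exp (b * L) - 1) / L)"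
  shows "measure_pmf.prob P {\<omega>. rank (Z \<omega>) = CARD('n) \<and> cond2 (Z \<omega>) \<le> sqrt ((1 + \<epsilon>) / (1 - \<epsilon>))}
    \<ge> 1 - real CARD('n) * (chernoff_f (- \<epsilon>) powr (1 / L) + chernoff_f \<epsilon> powr (1 / L))"
proof -
  define A where "A \<omega> x = (\<Sum>i\<in>UNIV. rank_one (Z \<omega> $ i) x)" for \<omega> x
  have A: "selfadjoint (A \<omega>)" for \<omega>
    unfolding A_def[abs_def] by (intro selfadjoint_intros)
  have Z: "(norm (Z \<omega> *v x))\<^sup>2 = x \<bullet> A \<omega> x" for \<omega> x
    by (simp add: norm_power2_rank_one A_def)
  note mgf = mgf[folded A_def]
  define bp where "bp = ln (1 + \<epsilon>) / L"
  \<comment> \<open>Written with \<open>1 + - \<epsilon>\<close> to match the tail bound at \<eta> =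
    -\<epsilon>; \<open>bm\<close> is negative, so \<open>Dm\<close> is the lower tail.\<close>
  define bm where "bm = ln (1 + - \<epsilon>) / L"
  have bpos: "0 < bp" "bm < 0" using \<epsilon> L by (auto simp: bp_def bm_def divide_neg_pos)
  define Dp where "Dp = {\<omega>. \<exists>x. norm x = 1 \<and> bp * (1 + \<epsilon>) < bp * (x \<bullet> A \<omega> x)}"
  define Dm where "Dm = {\<omega>. \<exists>x. norm x = 1 \<and> bm * (1 + - \<epsilon>) < bm * (x \<bullet> A \<omega> x)}"
  define G where "G = {\<omega>. rank (Z \<omega>) = CARD('n) \<and> cond2 (Z \<omega>) \<le> sqrt ((1 + \<epsilon>) / (1 - \<epsilon>))}"
  have Dp: "measure_pmf.prob P Dp \<le> real CARD('n) * chernoff_f \<epsilon> powr (1 / L)"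
    unfolding Dp_def using prob_quadratic_form_tail[OF fin A L _ bp_def] \<epsilon> mgf by simp
  have Dm: "measure_pmf.prob P Dm \<le> real CARD('n) * chernoff_f (- \<epsilon>) powr (1 / L)"
    unfolding Dm_def using prob_quadratic_form_tail[OF fin A L _ bm_def] \<epsilon> mgf by simp
  have "- G \<subseteq> Dm \<union> Dp"
  proof (rule subsetI, rule ccontr)
    fix \<omega> assume "\<omega> \<in> - G" and "\<omega> \<notin> Dm \<union> Dp"
    then have unit: "1 - \<epsilon> \<le> x \<bullet> A \<omega> x" "x \<bullet> A \<omega> x \<le> 1 + \<epsilon>" if "norm x = 1" for x
      using that bpos by (fastforce simp: Dm_def Dp_def)+
    have "(1 - \<epsilon>) * (norm x)\<^sup>2 \<le> (norm (Z \<omega> *v x))\<^sup>2 \<and> (norm (Z \<omega> *v x))\<^sup>2 \<le> (1 + \<epsilon>) * (norm x)\<^sup>2" for x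
    proof (cases "x = 0")
      case False
      define y where "y = x /\<^sub>R norm x"
      have y: "norm y = 1" and x: "x = norm x *\<^sub>R y" using False by (auto simp: y_def)
      have "norm (Z \<omega> *v x) = norm x * norm (Z \<omega> *v y)"
        by (subst x) (simp add: matrix_vector_mult_scaleR)
      then have "(norm (Z \<omega> *v x))\<^sup>2 = (norm x)\<^sup>2 * (y \<bullet> A \<omega> y)"
        by (simp add: power_mult_distrib Z)
      then show ?thesis using unit[OF y] by (simp add: mult.commute[of "(norm x)\<^sup>2"] mult_right_mono)
    qed simp
    then have "\<omega> \<in> G"
      unfolding G_def using \<epsilon> full_rank_cond2_le[of "1 - \<epsilon>" "Z \<omega>" "1 + \<epsilon>"] by simp
    with \<open>\<omega> \<in> - G\<close> show False by simp
  qed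
  then have "measure_pmf.prob P (- G) \<le> measure_pmf.prob P (Dm \<union> Dp)"
    by (intro measure_pmf.finite_measure_mono) auto
  also have "\<dots> \<le> measure_pmf.prob P Dm + measure_pmf.prob P Dp"
    by (intro measure_Un_le) auto
  finally have "measure_pmf.prob P (- G) \<le> measure_pmf.prob P Dm + measure_pmf.prob P Dp" .
  moreover have "measure_pmf.prob P (- G) = 1 - measure_pmf.prob P G"
    using measure_pmf.prob_compl[of G P] by (simp add: Compl_eq_Diff_UNIV)
  ultimately show ?thesis using Dp Dm by (simp add: G_def[symmetric] algebra_simps)
qed

section \<open>Rows of the sampled matrices\<close>

lemma axis_vector_matrix_mult: "axis j 1 v* Q = (Q $ j :: real^'n)"
  by (simp add: vec_eq_iff vector_matrix_mult_def axis_def if_distrib if_distribR cong: if_cong)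

lemma row_norm_le_coherence: "(norm (Q $ j))\<^sup>2 \<le> coherence Q"
  by (auto simp: coherence_def axis_vector_matrix_mult intro!: Max_ge)

lemma sum_rank_one_rows:
  fixes Q :: "real^'n^'m"
  shows "(\<Sum>t\<in>UNIV. rank_one (Q $ t) x) = (transpose Q ** Q) *v x"
proof -
  have "(transpose Q ** Q) *v x = transpose Q *v (Q *v x)" by (simp add: matrix_vector_mul_assoc)
  also have "\<dots> = (\<Sum>t\<in>UNIV. (Q *v x) $ t *\<^sub>R Q $ t)"
    by (simp add: vec_eq_iff matrix_vector_mult_def transpose_def mult.commute)
  finally show ?thesis by (simp add: rank_one_def matrix_vector_mul_component)
qed

lemma selection_matrix_row: "(selection_matrix k ** Q) $ i
    = (sqrt (real CARD('m) / real CARD('c)) *\<^sub>R Q $ (k i) :: real^'n)"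
  for k :: "'c::finite \<Rightarrow> 'm::finite"
  by (simp add: vec_eq_iff selection_matrix_def matrix_matrix_mult_def axis_def
      mult.assoc sum_distrib_left[symmetric] if_distrib[of "\<lambda>x. x * _"] cong: if_cong)

lemma diagonal_matrix_row: "((\<chi> s t. if s = t then d t else 0) ** Q) $ i = (d i *\<^sub>R Q $ i :: real^'n)"
  by (simp add: vec_eq_iff matrix_matrix_mult_def if_distrib[of "\<lambda>x. x * _"] cong: if_cong)

lemma rank_one_scaleR: "rank_one (c *\<^sub>R w) x = c\<^sup>2 *\<^sub>R rank_one w x"
  by (simp add: rank_one_def power2_eq_square)

section \<open>The three sampling methods\<close>

locale sampled_isometry =
  fixes Q :: "real^'n^'m" and c :: nat
  assumes orth: "transpose Q ** Q = mat 1" and c: "1 \<le> c" "c \<le> CARD('m)"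
begin

text \<open>The bound L on the squared norm of a row of S Q; 1 / L is the exponent c / (m \<mu>) in
  \<delta>.\<close>

definition scaled_coherence :: real where "scaled_coherence = real CARD('m) * coherence Q / real c"
text \<open>The row that a draw of index \<open>t\<close> contributes to S Q.\<close>

definition scaled_row :: "'m \<Rightarrow> real^'n" where "scaled_row t = sqrt (real CARD('m) / real c) *\<^sub>R Q $ t"

lemma sum_rank_one_rows_eq: "(\<Sum>t\<in>UNIV. rank_one (Q $ t) x) = x"
  by (simp add: sum_rank_one_rows orth)

text \<open>Otherwise every row would vanish, and Q^T Q could not be the identity on a space of
  positive dimension.\<close>

lemma coherence_pos: "0 < coherence Q"
proof (rule ccontr)
  assume "\<not> 0 < coherence Q"
  have "Q $ t = 0" for t
  proof -
    have "(norm (Q $ t))\<^sup>2 \<le> 0"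
      using row_norm_le_coherence[of Q t] \<open>\<not> 0 < coherence Q\<close> by linarith
    then show ?thesis by simp
  qed
  then have "x = 0" for x :: "real^'n"
    using sum_rank_one_rows_eq[of x] by (simp add: rank_one_def)
  then show False by (metis one_neq_zero zero_neq_one axis_eq_0_iff)
qed

lemma scaled_coherence_pos: "0 < scaled_coherence" using coherence_pos c by (simp add: scaled_coherence_def)

lemma norm_scaled_row_le: "(norm (scaled_row t))\<^sup>2 \<le> scaled_coherence"
  using row_norm_le_coherence[of Q t] c
  by (simp add: scaled_row_def scaled_coherence_def power_mult_distrib divide_right_mono)

lemma rank_one_scaled_row: "rank_one (scaled_row t) x = (real CARD('m) / real c) *\<^sub>R rank_one (Q $ t) x"
  using c by (simp add: scaled_row_def rank_one_scaleR)

lemma sum_rank_one_scaled_row: "(\<Sum>t\<in>UNIV. rank_one (scaled_row t) x) = (real CARD('m) / real c) *\<^sub>R x"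
  by (simp add: rank_one_scaled_row scaleR_sum_right[symmetric] sum_rank_one_rows_eq)

lemma sum_scaled_row_inner_power2: "(\<Sum>t\<in>UNIV. (scaled_row t \<bullet> x)\<^sup>2) = (real CARD('m) / real c) * (x \<bullet> x)"
proof -
  have "(\<Sum>t\<in>UNIV. (scaled_row t \<bullet> x)\<^sup>2) = x \<bullet> (\<Sum>t\<in>UNIV. rank_one (scaled_row t) x)"
    by (simp add: inner_sum_right rank_one_quadratic_form)
  then show ?thesis by (simp add: sum_rank_one_scaled_row)
qed

text \<open>Reindexing by \<open>r\<close> turns the sum over row labels into a sum over the first
  \<open>c\<close> entries of the permutation. The factor c / m of the general bound cancels the m /
  c in the sum over all scaled rows.\<close>

lemma mgf_without_replacement:
  fixes r :: "'c::finite \<Rightarrow> nat"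
  assumes "bij_betw r UNIV {..<c}"
  shows "measure_pmf.expectation (pmf_of_set (permutations_of_set (UNIV :: 'm set)))
      (\<lambda>ks. trexp (\<lambda>x. b *\<^sub>R (\<Sum>i\<in>UNIV. rank_one (scaled_row (ks ! r i)) x)))
    \<le> real CARD('n) * exp ((exp (b * scaled_coherence) - 1) / scaled_coherence)"
proof -
  have r: "(\<Sum>i\<in>UNIV. rank_one (scaled_row (ks ! r i)) x) = (\<Sum>i<c. rank_one (scaled_row (ks ! i)) x)" for ks x
    by (rule sum.reindex_bij_betw[OF assms])
  have "measure_pmf.expectation (pmf_of_set (permutations_of_set (UNIV :: 'm set)))
      (\<lambda>ks. trexp (\<lambda>x. 0 + b *\<^sub>R (\<Sum>i<c. rank_one (scaled_row (ks ! i)) x)))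
    \<le> trexp (\<lambda>x. 0 + (real c / real CARD('m) * ((exp (b * scaled_coherence) - 1) / scaled_coherence)) *\<^sub>R (\<Sum>t\<in>UNIV. rank_one (scaled_row t) x))"
    using c by (intro expectation_trexp_permutation_le norm_scaled_row_le scaled_coherence_pos selfadjoint_intros) auto
  also have "\<dots> = trexp (\<lambda>x :: real^'n. ((exp (b * scaled_coherence) - 1) / scaled_coherence) *\<^sub>R x)"
    using c by (simp add: sum_rank_one_scaled_row)
  finally show ?thesis by (simp add: r trexp_scaleR)
qed

text \<open>Averaging the scaled rows over m indices gives E (w w^T) = I / c for each draw, so K =
  (g / c) I works, and the \<open>c\<close> draws add up to g I.\<close>

lemma mgf_with_replacement:
  assumes "c = CARD('c::finite)"
  shows "measure_pmf.expectation (Pi_pmf (UNIV :: 'c set) d (\<lambda>_. pmf_of_set (UNIV :: 'm set)))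
      (\<lambda>k. trexp (\<lambda>x. b *\<^sub>R (\<Sum>i\<in>UNIV. rank_one (scaled_row (k i)) x)))
    \<le> real CARD('n) * exp ((exp (b * scaled_coherence) - 1) / scaled_coherence)"
proof -
  define g where "g = (exp (b * scaled_coherence) - 1) / scaled_coherence"
  have "measure_pmf.expectation (Pi_pmf (UNIV :: 'c set) d (\<lambda>_. pmf_of_set (UNIV :: 'm set)))
      (\<lambda>k. trexp (\<lambda>x. 0 + b *\<^sub>R (\<Sum>i\<in>UNIV. rank_one (scaled_row (k i)) x)))
    \<le> trexp (\<lambda>x :: real^'n. 0 + (\<Sum>i\<in>(UNIV :: 'c set). (g / real c) *\<^sub>R x))"
  proof (rule expectation_trexp_Pi_pmf_le[where w = "\<lambda>_. scaled_row" and K = "\<lambda>_ x. (g / real c) *\<^sub>R x"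
        and f = "\<lambda>_. 0", OF _ _ scaled_coherence_pos])
    show "selfadjoint (\<lambda>x :: real^'n. 0)" by (rule selfadjoint_zero)
    show "selfadjoint (\<lambda>x :: real^'n. (g / real c) *\<^sub>R x)" by (rule selfadjoint_scaleR_ident)
    fix x :: "real^'n"
    show "(exp (b * scaled_coherence) - 1) / scaled_coherence * measure_pmf.expectation (pmf_of_set UNIV) (\<lambda>k. (scaled_row k \<bullet> x)\<^sup>2)
       \<le> x \<bullet> (g / real c) *\<^sub>R x"
      by (simp add: integral_pmf_of_set sum_scaled_row_inner_power2 g_def)
  qed (auto simp: norm_scaled_row_le)
  also have "\<dots> = trexp (\<lambda>x :: real^'n. g *\<^sub>R x)"
    using c by (simp add: assms[symmetric] scaleR_sum_left[symmetric] del: sum_constant)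
       (simp add: sum_constant_scaleR assms[symmetric])
  finally show ?thesis by (simp add: trexp_scaleR g_def)
qed

text \<open>The terms are not identically distributed. A squared diagonal entry has mean (c / m) (m
  / c) = 1, so the term of row q of Q has mean q q^T and K = g q q^T; orthonormality of the columns
  makes these sum to g I.\<close>

lemma mgf_bernoulli:
  "measure_pmf.expectation
      (Pi_pmf (UNIV :: 'm set) 0 (\<lambda>_. map_pmf (\<lambda>b. if b then sqrt (real CARD('m) / real c) else 0)
         (bernoulli_pmf (real c / real CARD('m)))))
      (\<lambda>d. trexp (\<lambda>x. b *\<^sub>R (\<Sum>i\<in>UNIV. rank_one (d i *\<^sub>R Q $ i) x)))
    \<le> real CARD('n) * exp ((exp (b * scaled_coherence) - 1) / scaled_coherence)"
proof -
  define g where "g = (exp (b * scaled_coherence) - 1) / scaled_coherence"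
  define p where "p = map_pmf (\<lambda>b. if b then sqrt (real CARD('m) / real c) else 0)
         (bernoulli_pmf (real c / real CARD('m)))"
  have c': "real c / real CARD('m) \<in> {0..1}" using c by simp
  have "measure_pmf.expectation (Pi_pmf (UNIV :: 'm set) 0 (\<lambda>_. p))
      (\<lambda>d. trexp (\<lambda>x. 0 + b *\<^sub>R (\<Sum>i\<in>UNIV. rank_one (d i *\<^sub>R Q $ i) x)))
    \<le> trexp (\<lambda>x. 0 + (\<Sum>i\<in>UNIV. g *\<^sub>R rank_one (Q $ i) x))"
  proof (rule expectation_trexp_Pi_pmf_le[where w = "\<lambda>i d. d *\<^sub>R Q $ i"
        and K = "\<lambda>i x. g *\<^sub>R rank_one (Q $ i) x" and f = "\<lambda>_. 0", OF _ _ scaled_coherence_pos])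
    show "selfadjoint (\<lambda>x :: real^'n. 0)" by (rule selfadjoint_zero)
    show "selfadjoint (\<lambda>x. g *\<^sub>R rank_one (Q $ i) x)" for i by (intro selfadjoint_intros)
    show "finite (set_pmf p)" by (simp add: p_def)
    show "(norm (d *\<^sub>R Q $ i))\<^sup>2 \<le> scaled_coherence" if "d \<in> set_pmf p" for i d
      using that norm_scaled_row_le[of i] scaled_coherence_pos by (auto simp: p_def scaled_row_def)
    show "(exp (b * scaled_coherence) - 1) / scaled_coherence * measure_pmf.expectation p (\<lambda>k. (k *\<^sub>R Q $ i \<bullet> x)\<^sup>2)
        \<le> x \<bullet> g *\<^sub>R rank_one (Q $ i) x" for i x
      using c c' by (simp add: p_def g_def rank_one_quadratic_form power_mult_distrib)
  qed auto
  also have "\<dots> = trexp (\<lambda>x :: real^'n. g *\<^sub>R x)"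
    by (simp add: scaleR_sum_right[symmetric] sum_rank_one_rows_eq)
  finally show ?thesis by (simp add: trexp_scaleR g_def p_def)
qed

end

theorem theorem4p1:
  fixes Q :: "real^'n^'m" and r :: "'c::finite \<Rightarrow> nat"
    and c :: nat and \<epsilon> \<mu> \<delta> :: real
  assumes "transpose Q ** Q = mat 1"
    and "\<mu> = coherence Q"
    and "c = CARD('c)" and "bij_betw r (UNIV :: 'c set) {..<c}"
    and "CARD('n) \<le> c" and "c \<le> CARD('m)"
    and "0 < \<epsilon>" and "\<epsilon> < 1"
    and "\<delta> = real CARD('n) *
            (chernoff_f (- \<epsilon>) powr (real c / (real CARD('m) * \<mu>)) +
             chernoff_f \<epsilon> powr (real c / (real CARD('m) * \<mu>)))"
    and "\<delta> < 1"
  shows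
    "measure_pmf.prob (uniform_without_replacement r :: (real^'m^'c) pmf)
       {S. rank (S ** Q) = CARD('n) \<and> cond2 (S ** Q) \<le> sqrt ((1 + \<epsilon>) / (1 - \<epsilon>))} \<ge> 1 - \<delta> \<and>
     measure_pmf.prob (uniform_with_replacement :: (real^'m^'c) pmf)
       {S. rank (S ** Q) = CARD('n) \<and> cond2 (S ** Q) \<le> sqrt ((1 + \<epsilon>) / (1 - \<epsilon>))} \<ge> 1 - \<delta> \<and>
     measure_pmf.prob (bernoulli_sampling c :: (real^'m^'m) pmf)
       {S. rank (S ** Q) = CARD('n) \<and> cond2 (S ** Q) \<le> sqrt ((1 + \<epsilon>) / (1 - \<epsilon>))} \<ge> 1 - \<delta>"
proof -
  \<comment> \<open>The index type is nonempty, so \<open>c\<close> is positive as the locale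
    demands.\<close>
  have "1 \<le> CARD('n)" by (simp add: Suc_le_eq)
  then interpret sampled_isometry Q c
    using assms by unfold_locales auto
  have \<delta>: "\<delta> = real CARD('n) * (chernoff_f (- \<epsilon>) powr (1 / scaled_coherence) + chernoff_f \<epsilon> powr (1 / scaled_coherence))"
  proof -
    have "1 / scaled_coherence = real c / (real CARD('m) * \<mu>)" using assms(2) by (simp add: scaled_coherence_def)
    then show ?thesis using assms(9) by (simp only:)
  qed
  have row: "(selection_matrix k ** Q) $ i = scaled_row (k i)" for k :: "'c \<Rightarrow> 'm" and i
    by (simp add: selection_matrix_row scaled_row_def assms(3)[symmetric])
  note bound = prob_cond2_le[OF _ scaled_coherence_pos \<open>0 < \<epsilon>\<close> \<open>\<epsilon> < 1\<close>]
  \<comment> \<open>Each random matrix is the image of a permutation, an index function or a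
    diagonal, so the events are pulled back to the distribution of that object.\<close>
  show ?thesis
    unfolding uniform_without_replacement_def uniform_with_replacement_def bernoulli_sampling_def
      measure_map_pmf vimage_def mem_Collect_eq \<delta>
  proof (intro conjI)
    let ?lower = "1 - real CARD('n) * (chernoff_f (- \<epsilon>) powr (1 / scaled_coherence) + chernoff_f \<epsilon> powr (1 / scaled_coherence))"
    show "measure_pmf.prob (pmf_of_set (permutations_of_set UNIV))
       {ks. rank (selection_matrix (\<lambda>i. ks ! r i) ** Q) = CARD('n) \<and>
         cond2 (selection_matrix (\<lambda>i. ks ! r i) ** Q) \<le> sqrt ((1 + \<epsilon>) / (1 - \<epsilon>))} \<ge> ?lower"
      using mgf_without_replacement[OF assms(4)] by (intro bound) (simp_all add: row)
    show "measure_pmf.prob (Pi_pmf UNIV undefined (\<lambda>_. pmf_of_set UNIV))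
       {k. rank (selection_matrix (k :: 'c \<Rightarrow> 'm) ** Q) = CARD('n) \<and>
         cond2 (selection_matrix k ** Q) \<le> sqrt ((1 + \<epsilon>) / (1 - \<epsilon>))} \<ge> ?lower"
      using mgf_with_replacement[OF assms(3)]
      by (intro bound) (auto intro: finite_set_Pi_pmf simp: row)
    let ?D = "\<lambda>d :: 'm \<Rightarrow> real. \<chi> s t. if s = t then d t else 0"
    show "measure_pmf.prob
       (Pi_pmf UNIV 0 (\<lambda>_. map_pmf (\<lambda>b. if b then sqrt (real CARD('m) / real c) else 0)
         (bernoulli_pmf (real c / real CARD('m)))))
       {d. rank (?D d ** Q) = CARD('n) \<and> cond2 (?D d ** Q) \<le> sqrt ((1 + \<epsilon>) / (1 - \<epsilon>))} \<ge> ?lower"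
      using mgf_bernoulli
      by (intro bound) (auto intro: finite_set_Pi_pmf simp: diagonal_matrix_row)
  qed
qed

end
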